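(* Let $j$ be a positive integer. Then, as an identity of polynomials in complex variables $d,e$, \[ \operatorname{Ch}_{2j}\big( (e-d) \times (e+d) \big) = (-1)^{j-1} \binom{2j-1}{j} \sum_{k=0}^{j} g_k(j)\, 2d\left( \prod_{r=1}^{k} (d^2-r^2) \right) \left( \prod_{r=k+1}^{j} (e^2-r^2) \right), \] where $g_0(j)=1$ and $g_k(j)= (-1)^{k} \frac{j^{\downarrow k} \, (2j+1)^{\uparrow \uparrow k}}{k! \, (2k+1)!!}$ for $1 \le k \le j$.
   Context: For a partition $\pi$ of $k$ and a partition $\lambda$ of $n$, $\operatorname{Ch}_\pi(\lambda)= n^{\downarrow k}\, \chi^\lambda_{\pi\cup(1^{n-k})}/f^\lambda$ if $n\ge k$ and $0$ otherwise ($\chi^\lambda_\mu$ the irreducible character of $\mathfrak{S}_n$ at cycle type $\mu$, $f^\lambda$ its dimension, $n^{\downarrow k}=n(n-1)\cdots(n-k+1)$); $\operatorname{Ch}_k:=\operatorname{Ch}_{(k)}$. $p\times q$ is the rectangular Young diagram with $p$ rows of length $q$. For fixed $\pi$ there is a unique polynomial in $\mathbb{Q}[p,q]$ agreeing with $\operatorname{Ch}_\pi(p\times q)$ at all positive integers $p,q$ (namely $(-1)^k\sum_{\sigma_1\sigma_2=w_\pi}(-q)^{\kappa(\sigma_1)}p^{\kappa(\sigma_2)}$ over $\sigma_1,\sigma_2\in\mathfrak{S}_k$, $w_\pi$ of cycle type $\pi$, $\kappa$ = number of cycles); for complex $p,q$, $\operatorname{Ch}_\pi(p\times q)$ means this polynomial's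 value. $a^{\uparrow\uparrow k}=\prod_{r=0}^{k-1}(a+2r)$, $a^{\uparrow\uparrow0}=1$. *)

theory Defs
  imports
    Complex_Main
    "HOL-Library.Multiset"
    "HOL-Library.Function_Algebras"
    "HOL-Combinatorics.Permutations"
    "HOL-Combinatorics.Orbits"
    "HOL-Computational_Algebra.Polynomial"
begin

definition falling :: "'a::comm_ring_1 \<Rightarrow> nat \<Rightarrow> 'a"
  where "falling a k = (\<Prod>r<k. a - of_nat r)"

definition rising2 :: "'a::comm_semiring_1 \<Rightarrow> nat \<Rightarrow> 'a"
  where "rising2 a k = (\<Prod>r<k. a + 2 * of_nat r)"

fun dfact :: "nat \<Rightarrow> nat"
  where
    "dfact 0 = 1"
  | "dfact (Suc 0) = 1"
  | "dfact (Suc (Suc n)) = Suc (Suc n) * dfact n"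


section \<open>Young diagrams\<close>

text \<open>
  A partition is the multiset of its (positive) parts.  Its Young diagram is drawn with row and
  column indices starting from 0.
\<close>

definition parts :: "nat multiset \<Rightarrow> nat list"
  where "parts \<nu> = rev (sorted_list_of_multiset \<nu>)"

text \<open>
  The boxes of the diagram as (row, column), listed row by row.  This list is also the standard
  tableau used to build the Young symmetrizer: the entry \<open>m\<close>, for \<open>0 \<le> m < n\<close>, sits in the
  \<open>m\<close>-th box of the list.
\<close>

definition boxes :: "nat multiset \<Rightarrow> (nat \<times> nat) list"
  where "boxes \<nu> = concat (map (\<lambda>i. map (Pair i) [0..<parts \<nu> ! i]) [0..<size \<nu>])"

definition rect :: "nat \<Rightarrow> nat \<Rightarrow> nat multiset"
  where "rect p q = replicate_mset p q"


section \<open>Irreducible characters of the symmetric groups\<close>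

text \<open>The symmetric group of degree \<open>n\<close> is taken as the permutations of \<open>{0, \<dots>, n - 1}\<close>.\<close>

definition Sym :: "nat \<Rightarrow> (nat \<Rightarrow> nat) set"
  where "Sym n = {w. w permutes {..<n}}"

definition cycle_type :: "nat \<Rightarrow> (nat \<Rightarrow> nat) \<Rightarrow> nat multiset"
  where "cycle_type n w = image_mset card (mset_set (orbit w ` {..<n}))"

text \<open>
  The group algebra consists of the complex functions on permutations that vanish outside
  \<open>Sym n\<close>; a function \<open>x\<close> stands for the formal sum of \<open>x w \<cdot> w\<close>.
\<close>

type_synonym galg = "(nat \<Rightarrow> nat) \<Rightarrow> complex"

definition group_algebra :: "nat \<Rightarrow> galg set"
  where "group_algebra n = {x. \<forall>w. w \<notin> Sym n \<longrightarrow> x w = 0}"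

definition gscale :: "complex \<Rightarrow> galg \<Rightarrow> galg"
  where "gscale c x = (\<lambda>w. c * x w)"

global_interpretation galg: vector_space gscale
  by unfold_locales (auto simp: gscale_def fun_eq_iff algebra_simps)

definition gmult :: "nat \<Rightarrow> galg \<Rightarrow> galg \<Rightarrow> galg"
  where "gmult n x y = (\<lambda>w. \<Sum>u\<in>Sym n. \<Sum>v\<in>Sym n. if u \<circ> v = w then x u * y v else 0)"

definition gelem :: "(nat \<Rightarrow> nat) \<Rightarrow> galg"
  where "gelem w = (\<lambda>u. if u = w then 1 else 0)"

definition row_group :: "nat multiset \<Rightarrow> (nat \<Rightarrow> nat) set"
  where "row_group \<nu> =
    {w \<in> Sym (sum_mset \<nu>). \<forall>m<sum_mset \<nu>. fst (boxes \<nu> ! w m) = fst (boxes \<nu> ! m)}"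

definition column_group :: "nat multiset \<Rightarrow> (nat \<Rightarrow> nat) set"
  where "column_group \<nu> =
    {w \<in> Sym (sum_mset \<nu>). \<forall>m<sum_mset \<nu>. snd (boxes \<nu> ! w m) = snd (boxes \<nu> ! m)}"

definition young_symmetrizer :: "nat multiset \<Rightarrow> galg"
  where "young_symmetrizer \<nu> =
    gmult (sum_mset \<nu>)
      (\<Sum>u\<in>row_group \<nu>. gelem u)
      (\<Sum>v\<in>column_group \<nu>. gscale (of_int (sign v)) (gelem v))"

text \<open>The irreducible representation indexed by \<open>\<nu>\<close>: the left ideal generated by the symmetrizer.\<close>

definition specht :: "nat multiset \<Rightarrow> galg set"
  where "specht \<nu> =
    (\<lambda>x. gmult (sum_mset \<nu>) x (young_symmetrizer \<nu>)) ` group_algebra (sum_mset \<nu>)"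

text \<open>
  Trace of a linear operator \<open>T\<close> on a finite-dimensional \<open>T\<close>-invariant subspace \<open>V\<close>; it does not
  depend on the basis that is chosen.
\<close>

definition trace_on :: "galg set \<Rightarrow> (galg \<Rightarrow> galg) \<Rightarrow> complex"
  where "trace_on V T =
    (let B = (SOME B. galg.independent B \<and> galg.span B = V)
     in \<Sum>b\<in>B. galg.representation B (T b) b)"

definition irr_character :: "nat multiset \<Rightarrow> (nat \<Rightarrow> nat) \<Rightarrow> complex"
  where "irr_character \<nu> w = trace_on (specht \<nu>) (gmult (sum_mset \<nu>) (gelem w))"

definition irr_dim :: "nat multiset \<Rightarrow> nat"
  where "irr_dim \<nu> = galg.dim (specht \<nu>)"

definition irr_character_at :: "nat multiset \<Rightarrow> nat multiset \<Rightarrow> complex"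
  where "irr_character_at \<nu> \<mu> =
    irr_character \<nu> (SOME w. w \<in> Sym (sum_mset \<nu>) \<and> cycle_type (sum_mset \<nu>) w = \<mu>)"


section \<open>Normalized characters\<close>

definition Ch :: "nat multiset \<Rightarrow> nat multiset \<Rightarrow> complex"
  where "Ch \<pi> \<nu> =
    (let k = sum_mset \<pi>; n = sum_mset \<nu>
     in if k \<le> n
        then falling (of_nat n) k * irr_character_at \<nu> (\<pi> + replicate_mset (n - k) 1)
               / of_nat (irr_dim \<nu>)
        else 0)"

text \<open>
  Elements of \<open>\<rat>[p, q]\<close> are represented as polynomials in \<open>p\<close> whose coefficients are polynomials
  in \<open>q\<close>.
\<close>

definition eval2 :: "rat poly poly \<Rightarrow> complex \<Rightarrow> complex \<Rightarrow> complex"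
  where "eval2 P p q = poly (map_poly (\<lambda>c. poly (map_poly of_rat c) q) P) p"

definition Ch_rect_poly :: "nat multiset \<Rightarrow> rat poly poly"
  where "Ch_rect_poly \<pi> =
    (THE P. \<forall>p q. 0 < p \<longrightarrow> 0 < q \<longrightarrow> eval2 P (of_nat p) (of_nat q) = Ch \<pi> (rect p q))"

definition Ch_rect :: "nat multiset \<Rightarrow> complex \<Rightarrow> complex \<Rightarrow> complex"
  where "Ch_rect \<pi> p q = eval2 (Ch_rect_poly \<pi>) p q"

definition gcoeff :: "nat \<Rightarrow> nat \<Rightarrow> complex"
  where "gcoeff k j =
    (if k = 0 then 1
     else (-1) ^ k * (falling (of_nat j) k * rising2 (2 * of_nat j + 1) k)
            / (fact k * of_nat (dfact (2 * k + 1))))"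

end

theory Submission
  imports Defs "HOL-Library.FuncSet"
begin

text \<open>
  For a rectangle the Young symmetrizer \<open>c\<close> satisfies \<open>c\<^sup>2 = \<gamma> c\<close>, because a permutation either
  factors into a row and a column permutation or admits a sign-reversing transposition; taking
  traces, \<open>\<chi>(w) / f\<close> is the average of \<open>c\<close> over the conjugates of the inverse of \<open>w\<close>. Reading a
  conjugate as an injective placement of the support of \<open>w\<close> in the rectangle, and adding the
  non-injective maps, whose signed contributions cancel, \<open>Ch\<^sub>k(p \<times> q)\<close> becomes the signed sum of
  \<open>p\<^bsup>\<kappa>(\<sigma>\<^sub>1)\<^esup> q\<^bsup>\<kappa>(\<sigma>\<^sub>2)\<^esup>\<close> over the factorizations \<open>\<sigma>\<^sub>1 \<sigma>\<^sub>2\<close> of a \<open>k\<close>-cycle.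

  The indicator of the \<open>k\<close>-cycles is a signed combination of hook symmetrizers, and each of these
  is a common eigenvector of the Jucys--Murphy elements, whose eigenvalues are the contents of the
  hook. Hence \<open>k! Ch\<^sub>k(p \<times> q)\<close> is the alternating sum over \<open>m\<close> of
  \<open>(k-1 choose m) (p+k-1-m)\<^bsup>\<down>k\<^esup> (q+m)\<^bsup>\<down>k\<^esup>\<close>.

  For \<open>p = e - d\<close> and \<open>q = e + d\<close> this is, up to sign, the difference of order \<open>k - 1\<close> at \<open>d\<close> of
  the product of the \<open>e\<^sup>2 - (t - i)\<^sup>2\<close> over \<open>i < k\<close>. If \<open>k = 2 j\<close>, that is an odd polynomial in \<open>d\<close>
  of degree at most \<open>2 j + 1\<close>, to which Stirling's formula applies: its differences of order
  \<open>2 i + 1\<close> at \<open>-i\<close> are polynomials in \<open>x = e\<^sup>2\<close> of degree at most \<open>j - i\<close>. At \<open>x = r\<^sup>2\<close> for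
  \<open>i < r \<le> j\<close> every term of the difference vanishes, and at \<open>x = i\<^sup>2\<close> every term but one.
\<close>


section \<open>Falling factorials and finite differences\<close>

lemma falling_0 [simp]: "falling a 0 = 1"
  by (simp add: falling_def)

lemma falling_Suc: "falling a (Suc k) = falling a k * (a - of_nat k)"
  by (simp add: falling_def)

lemma falling_Suc_shift: "falling (a + 1) (Suc k) = (a + 1) * falling a k"
  unfolding falling_def by (subst prod.lessThan_Suc_shift) (simp add: algebra_simps)

lemma falling_of_nat_mult_fact:
  "k \<le> n \<Longrightarrow> falling (of_nat n :: 'a::{comm_ring_1,semiring_char_0}) k * fact (n - k) = fact n"
proof (induction k)
  case (Suc k)
  then have "n - k = Suc (n - Suc k)" by simp
  then have "fact (n - k) = (of_nat (n - k) :: 'a) * fact (n - Suc k)"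
    by (metis fact_Suc)
  with Suc show ?case
    by (simp add: falling_Suc of_nat_diff mult.assoc mult.left_commute)
qed simp

lemma falling_of_nat_self: "falling (of_nat n :: 'a::{comm_ring_1,semiring_char_0}) n = fact n"
  using falling_of_nat_mult_fact [of n n, where 'a = 'a] by simp

lemma falling_of_nat_eq_0: "n < k \<Longrightarrow> falling (of_nat n :: 'a::comm_ring_1) k = 0"
  unfolding falling_def by (rule prod_zero) auto

lemma prod_square_diff_eq_falling:
  fixes d :: "'a::comm_ring_1"
  shows "d * (\<Prod>r = 1..k. d\<^sup>2 - (of_nat r)\<^sup>2) = falling (of_nat k + d) (2 * k + 1)"
proof (induction k)
  case (Suc k)
  have "falling (of_nat (Suc k) + d) (2 * Suc k + 1) =
      falling (of_nat k + d + 1) (Suc (Suc (2 * k + 1)))"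
    by (simp add: add_ac)
  also have "\<dots> = (of_nat k + d + 1) *
      (falling (of_nat k + d) (2 * k + 1) * (of_nat k + d - of_nat (2 * k + 1)))"
    by (simp only: falling_Suc_shift falling_Suc [of "of_nat k + d"])
  also have "\<dots> = d * (\<Prod>r = 1..k. d\<^sup>2 - (of_nat r)\<^sup>2) * (d\<^sup>2 - (of_nat (Suc k))\<^sup>2)"
    unfolding Suc.IH [symmetric] by (simp add: algebra_simps power2_eq_square)
  finally show ?case by (simp add: mult.assoc)
qed (simp add: falling_def)

definition fdiff :: "('a::comm_ring_1 \<Rightarrow> 'a) \<Rightarrow> 'a \<Rightarrow> 'a"
  where "fdiff f = (\<lambda>t. f (t + 1) - f t)"

lemma sum_binomial_Suc:
  fixes X :: "nat \<Rightarrow> 'a::comm_semiring_1"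
  shows "(\<Sum>a\<le>Suc N. of_nat (Suc N choose a) * X a) =
    (\<Sum>a\<le>N. of_nat (N choose a) * (X a + X (Suc a)))"
proof -
  have "(\<Sum>a\<le>Suc N. of_nat (Suc N choose a) * X a) =
      X 0 + (\<Sum>a\<le>N. of_nat (N choose Suc a) * X (Suc a)) + (\<Sum>a\<le>N. of_nat (N choose a) * X (Suc a))"
    by (subst sum.atMost_Suc_shift) (simp add: distrib_right sum.distrib add_ac)
  also have "X 0 + (\<Sum>a\<le>N. of_nat (N choose Suc a) * X (Suc a)) =
      (\<Sum>a\<le>Suc N. of_nat (N choose a) * X a)"
    by (subst sum.atMost_Suc_shift) (simp add: binomial_eq_0)
  finally show ?thesis by (simp add: distrib_left sum.distrib binomial_eq_0)
qed

lemma fdiff_funpow_eq_sum: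
  "(fdiff ^^ N) f t = (\<Sum>i\<le>N. of_nat (N choose i) * ((-1) ^ (N - i) * f (t + of_nat i)))"
proof (induction N arbitrary: t)
  case (Suc N)
  have "(fdiff ^^ Suc N) f t = (fdiff ^^ N) f (t + 1) - (fdiff ^^ N) f t"
    by (simp add: fdiff_def)
  also have "\<dots> = (\<Sum>i\<le>N. of_nat (N choose i) *
      ((-1) ^ (Suc N - i) * f (t + of_nat i) + (-1) ^ (Suc N - Suc i) * f (t + of_nat (Suc i))))"
    unfolding Suc sum_subtractf [symmetric]
    by (intro sum.cong refl) (simp add: Suc_diff_le algebra_simps)
  finally show ?case
    unfolding sum_binomial_Suc .
qed simp

lemma fdiff_funpow_scale: "(fdiff ^^ N) (\<lambda>t. c * f t) = (\<lambda>t. c * (fdiff ^^ N) f t)"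
  by (induction N) (simp_all add: fdiff_def algebra_simps)

lemma fdiff_funpow_sum: "(fdiff ^^ N) (\<lambda>t. \<Sum>x\<in>A. f x t) = (\<lambda>t. \<Sum>x\<in>A. (fdiff ^^ N) (f x) t)"
  by (rule ext) (simp add: fdiff_funpow_eq_sum sum_distrib_left sum.swap [of _ A])

lemma fdiff_funpow_diff:
  "(fdiff ^^ N) (\<lambda>t. f t - g t) = (\<lambda>t. (fdiff ^^ N) f t - (fdiff ^^ N) g t)"
  by (rule ext) (simp add: fdiff_funpow_eq_sum sum_subtractf algebra_simps)

lemma fdiff_falling: "fdiff (\<lambda>t. falling (x + t) n) = (\<lambda>t. of_nat n * falling (x + t) (n - 1))"
proof (cases n)
  case (Suc m)
  have "falling (x + (t + 1)) (Suc m) - falling (x + t) (Suc m) =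
      of_nat (Suc m) * falling (x + t) m" for t
    using falling_Suc_shift [of "x + t" m] by (simp add: falling_Suc algebra_simps)
  then show ?thesis by (simp add: fdiff_def Suc)
qed (simp add: fdiff_def)

lemma fdiff_funpow_falling:
  fixes x :: "'a::comm_ring_1"
  shows "(fdiff ^^ a) (\<lambda>t. falling (x + t) n) =
      (\<lambda>t. falling (of_nat n) a * falling (x + t) (n - a))"
proof (induction a)
  case (Suc a)
  have "falling (of_nat n) a * of_nat (n - a) = (falling (of_nat n) (Suc a) :: 'a)"
    by (cases "a \<le> n") (simp_all add: falling_Suc of_nat_diff falling_of_nat_eq_0)
  moreover have "fdiff (\<lambda>t. c * g t) = (\<lambda>t. c * fdiff g t)" for c :: 'a and g
    using fdiff_funpow_scale [of 1] by simp
  ultimately show ?case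
    using Suc by (simp add: fdiff_falling mult.assoc [symmetric])
qed simp

lemma fdiff_funpow_reflect:
  assumes "\<And>t. f (of_nat N - t) = f t"
  shows "(fdiff ^^ N) f (- t) = (-1) ^ N * (fdiff ^^ N) f t"
proof -
  have reflected: "f (- t + of_nat i) = f (t + of_nat (N - i))" if "i \<le> N" for i
    using assms [of "- t + of_nat i"] that by (simp add: of_nat_diff algebra_simps)
  have "(fdiff ^^ N) f (- t) =
      (\<Sum>i\<le>N. of_nat (N choose i) * ((-1) ^ (N - i) * f (t + of_nat (N - i))))"
    unfolding fdiff_funpow_eq_sum by (intro sum.cong refl) (simp only: reflected atMost_iff)
  also have "\<dots> = (\<Sum>i\<le>N. of_nat (N choose i) * ((-1) ^ i * f (t + of_nat i)))"
    by (rule sum.reindex_bij_witness [of _ "\<lambda>i. N - i" "\<lambda>i. N - i"])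
      (auto simp: binomial_symmetric [symmetric])
  also have "\<dots> = (-1) ^ N * (fdiff ^^ N) f t"
    unfolding fdiff_funpow_eq_sum sum_distrib_left
  proof (intro sum.cong refl)
    fix i assume "i \<in> {..N}"
    then have "(-1) ^ N * (-1) ^ (N - i) = ((-1) ^ i :: 'a)"
      by (simp add: minus_one_power_iff)
    then show "of_nat (N choose i) * ((-1) ^ i * f (t + of_nat i)) =
        (-1) ^ N * (of_nat (N choose i) * ((-1) ^ (N - i) * f (t + of_nat i)))"
      by (metis mult.assoc mult.left_commute)
  qed
  finally show ?thesis .
qed


section \<open>Polynomial functions of bounded degree\<close>

definition polyfun :: "nat \<Rightarrow> ('a::comm_ring_1 \<Rightarrow> 'a) \<Rightarrow> bool"
  where "polyfun m f \<longleftrightarrow> (\<exists>P. degree P \<le> m \<and> f = poly P)"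

lemma polyfunI: "degree P \<le> m \<Longrightarrow> (\<And>x. f x = poly P x) \<Longrightarrow> polyfun m f"
  by (auto simp: polyfun_def fun_eq_iff)

lemma polyfun_mono: "polyfun m f \<Longrightarrow> m \<le> m' \<Longrightarrow> polyfun m' f"
  unfolding polyfun_def by (blast intro: order_trans)

lemma polyfun_const: "polyfun m (\<lambda>x. c)"
  by (rule polyfunI [of "[:c:]"]) simp_all

lemma polyfun_linear: "polyfun 1 (\<lambda>x. a * x + b)"
  by (rule polyfunI [of "[:b, a:]"]) simp_all

lemma polyfun_mult:
  assumes "polyfun m f" "polyfun m' g"
  shows "polyfun (m + m') (\<lambda>x. f x * g x)"
proof -
  from assms obtain P Q where "degree P \<le> m" "f = poly P" "degree Q \<le> m'" "g = poly Q"
    unfolding polyfun_def by blast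
  then show ?thesis
    by (intro polyfunI [of "P * Q"]) (auto intro: order_trans [OF degree_mult_le])
qed

lemma polyfun_scale: "polyfun m f \<Longrightarrow> polyfun m (\<lambda>x. c * f x)"
  using polyfun_mult [OF polyfun_const [of 0 c]] by simp

lemma polyfun_diff:
  assumes "polyfun m f" "polyfun m g"
  shows "polyfun m (\<lambda>x. f x - g x)"
proof -
  from assms obtain P Q where "degree P \<le> m" "f = poly P" "degree Q \<le> m" "g = poly Q"
    unfolding polyfun_def by blast
  then show ?thesis
    by (intro polyfunI [of "P - Q"]) (simp_all add: degree_diff_le)
qed

lemma polyfun_sum:
  assumes "\<And>i. i \<in> A \<Longrightarrow> polyfun m (f i)"
  shows "polyfun m (\<lambda>x. \<Sum>i\<in>A. f i x)"
  using assms
proof (induction A rule: infinite_finite_induct)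
  case (insert i A)
  have "polyfun m (\<lambda>x. f i x - (-1) * (\<Sum>i\<in>A. f i x))"
    using insert by (intro polyfun_diff polyfun_scale) auto
  with insert show ?case by simp
qed (simp_all add: polyfun_const)

lemma polyfun_prod:
  assumes "finite A" "\<And>i. i \<in> A \<Longrightarrow> polyfun m (f i)"
  shows "polyfun (m * card A) (\<lambda>x. \<Prod>i\<in>A. f i x)"
  using assms
proof (induction A)
  case (insert i A)
  then show ?case
    using polyfun_mult [of m "f i" "m * card A"] by simp
qed (simp add: polyfun_const)

lemma polyfun_falling: "polyfun k (\<lambda>x. falling (b + x) k)"
proof -
  have "polyfun 1 (\<lambda>x. b + x - of_nat i)" for i
    using polyfun_linear [of 1 "b - of_nat i"] by (simp add: algebra_simps)
  then show ?thesis
    using polyfun_prod [of "{..<k}" 1 "\<lambda>i x. b + x - of_nat i"] by (simp add: falling_def)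
qed

lemma polyfun_eqI:
  fixes f g :: "'a::idom \<Rightarrow> 'a"
  assumes "polyfun m f" "polyfun m g" "m < card A" "\<And>x. x \<in> A \<Longrightarrow> f x = g x"
  shows "f = g"
proof -
  from assms(1,2) obtain P Q where "degree P \<le> m" "f = poly P" "degree Q \<le> m" "g = poly Q"
    unfolding polyfun_def by blast
  with assms(3,4) show ?thesis
    using poly_eqI_degree [of A P Q] by simp
qed

lemma polyfun_fdiff:
  fixes f :: "'a::idom \<Rightarrow> 'a"
  assumes "polyfun m f"
  shows "polyfun (m - 1) (fdiff f)"
proof -
  obtain P where P: "degree P \<le> m" "f = poly P"
    using assms unfolding polyfun_def by blast
  define Q where "Q = P \<circ>\<^sub>p [:1, 1:] - P"
  have degree: "degree (P \<circ>\<^sub>p [:1, 1:]) = degree P"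
    by (simp add: degree_pcompose)
  then have top: "coeff (P \<circ>\<^sub>p [:1, 1:]) (degree P) = lead_coeff P"
    using lead_coeff_comp [of "[:1, 1:]" P] by simp
  have "degree Q \<le> degree P - 1"
  proof (cases "degree P = 0")
    case True
    then show ?thesis
      using degree degree_diff_le [of "P \<circ>\<^sub>p [:1, 1:]" 0 P] by (simp add: Q_def)
  next
    case False
    have "coeff Q k = 0" if "degree P \<le> k" for k
      using that top degree by (cases "k = degree P") (auto simp: Q_def coeff_eq_0)
    with False have "degree Q < degree P"
      by (intro degree_lessI) auto
    then show ?thesis by simp
  qed
  then show ?thesis
    using P by (intro polyfunI [of Q]) (simp_all add: fdiff_def Q_def poly_pcompose add.commute)
qed

lemma polyfun_fdiff_funpow:
  fixes f :: "'a::idom \<Rightarrow> 'a"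
  assumes "polyfun m f"
  shows "polyfun (m - N) ((fdiff ^^ N) f)"
proof (induction N)
  case (Suc N)
  from polyfun_fdiff [OF this] show ?case by simp
qed (simp add: assms)

lemma fdiff_funpow_eq_0:
  fixes f :: "'a::idom \<Rightarrow> 'a"
  assumes "polyfun m f" "m < N"
  shows "(fdiff ^^ N) f = (\<lambda>t. 0)"
proof -
  obtain N' where N': "N = Suc N'" "m \<le> N'"
    using assms(2) by (cases N) auto
  have "polyfun 0 ((fdiff ^^ N') f)"
    using polyfun_fdiff_funpow [OF assms(1), of N'] N'(2) by simp
  then obtain P where "degree P = 0" "(fdiff ^^ N') f = poly P"
    unfolding polyfun_def by auto
  then show ?thesis
    by (auto simp: N'(1) fdiff_def elim!: degree_eq_zeroE)
qed

lemma polyfun_fdiff_funpow_prod_diff: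
  fixes g :: "'i \<Rightarrow> 'a::idom \<Rightarrow> 'a"
  assumes "finite A" "\<And>i. i \<in> A \<Longrightarrow> polyfun m (g i)"
    and "polyfun c f" "c + m * card A < N + m * Suc D"
  shows "polyfun D (\<lambda>x. (fdiff ^^ N) (\<lambda>t. f t * (\<Prod>i\<in>A. x - g i t)) t)"
  using assms
proof (induction A arbitrary: c f D)
  case (insert i A)
  have "polyfun D (\<lambda>x. x * (fdiff ^^ N) (\<lambda>t. f t * (\<Prod>i\<in>A. x - g i t)) t)"
  proof (cases D)
    case 0
    have "(fdiff ^^ N) (\<lambda>t. f t * (\<Prod>i\<in>A. x - g i t)) = (\<lambda>t. 0)" for x
      using insert.prems insert.hyps 0
      by (intro fdiff_funpow_eq_0 [where m = "c + m * card A"] polyfun_mult polyfun_prod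
          polyfun_diff polyfun_const) auto
    then show ?thesis by (simp add: polyfun_const)
  next
    case (Suc D')
    then have "polyfun D' (\<lambda>x. (fdiff ^^ N) (\<lambda>t. f t * (\<Prod>i\<in>A. x - g i t)) t)"
      using insert.prems insert.hyps by (intro insert.IH [where c = c]) auto
    then show ?thesis
      using polyfun_mult [OF polyfun_linear [of 1 0]] by (simp add: Suc)
  qed
  moreover have "polyfun D (\<lambda>x. (fdiff ^^ N) (\<lambda>t. f t * g i t * (\<Prod>i\<in>A. x - g i t)) t)"
    using insert.prems insert.hyps
    by (intro insert.IH [where c = "c + m"] polyfun_mult) auto
  moreover have "(\<lambda>t. f t * (\<Prod>i\<in>insert i A. x - g i t)) =
      (\<lambda>t. x * (f t * (\<Prod>i\<in>A. x - g i t)) - f t * g i t * (\<Prod>i\<in>A. x - g i t))" for x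
    using insert.hyps by (simp add: algebra_simps)
  ultimately show ?case
    by (simp add: fdiff_funpow_diff fdiff_funpow_scale polyfun_diff)
qed (simp add: polyfun_const)


section \<open>Interpolation of odd polynomials\<close>

lemma odd_polyfun_eq_0:
  fixes h :: "'a::field_char_0 \<Rightarrow> 'a"
  assumes "polyfun (2 * j + 1) h" and odd: "\<And>x. h (- x) = - h x"
    and zero: "\<And>i. i \<le> j + 1 \<Longrightarrow> h (of_nat i) = 0"
  shows "h = (\<lambda>x. 0)"
proof (rule polyfun_eqI [OF assms(1) polyfun_const])
  show "2 * j + 1 < card (of_int ` {- int (j + 1)..int (j + 1)} :: 'a set)"
    by (simp add: card_image inj_on_def)
  fix x :: 'a assume "x \<in> of_int ` {- int (j + 1)..int (j + 1)}"
  then obtain i where i: "x = of_int i" "\<bar>i\<bar> \<le> int (j + 1)" by auto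
  then consider "x = of_nat (nat \<bar>i\<bar>)" | "x = - of_nat (nat \<bar>i\<bar>)"
    by (cases "0 \<le> i") auto
  then show "h x = 0"
    using zero [of "nat \<bar>i\<bar>"] i(2) odd by cases auto
qed

lemma odd_central_fdiff_eq_outer_value:
  assumes odd: "\<And>x. h (- x) = - h x" and zero: "\<And>l. l \<le> k \<Longrightarrow> h (of_nat l) = 0"
  shows "(fdiff ^^ (2 * k + 1)) h (- of_nat k) = h (of_nat (Suc k))"
proof -
  have inner: "h (of_nat l - of_nat k) = 0" if "l \<le> 2 * k" for l
  proof (cases "k \<le> l")
    case True
    then show ?thesis using zero [of "l - k"] that by (simp add: of_nat_diff)
  next
    case False
    then have "h (of_nat l - of_nat k) = - h (of_nat (k - l))"
      using odd [of "of_nat (k - l)"] by (simp add: of_nat_diff)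
    then show ?thesis using zero [of "k - l"] by simp
  qed
  have "(\<Sum>l\<le>2 * k. of_nat (Suc (2 * k) choose l) *
      ((-1) ^ (Suc (2 * k) - l) * h (- of_nat k + of_nat l))) = 0"
    by (intro sum.neutral ballI) (simp add: inner)
  then have "(fdiff ^^ Suc (2 * k)) h (- of_nat k) = h (of_nat (Suc (2 * k)) - of_nat k)"
    unfolding fdiff_funpow_eq_sum sum.atMost_Suc by simp
  then show ?thesis by (simp add: add.commute)
qed

lemma odd_polyfun_eq_0_if_central_fdiff_eq_0:
  fixes h :: "'a::field_char_0 \<Rightarrow> 'a"
  assumes "polyfun (2 * j + 1) h" and odd: "\<And>x. h (- x) = - h x"
    and central: "\<And>k. k \<le> j \<Longrightarrow> (fdiff ^^ (2 * k + 1)) h (- of_nat k) = 0"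
  shows "h = (\<lambda>x. 0)"
proof (rule odd_polyfun_eq_0 [OF assms(1) odd])
  fix i assume "i \<le> j + 1"
  then show "h (of_nat i) = 0"
  proof (induction i rule: less_induct)
    case (less i)
    show ?case
    proof (cases i)
      case 0
      then show ?thesis using odd [of 0] by simp
    next
      case (Suc k)
      then have "h (of_nat l) = 0" if "l \<le> k" for l
        using that less by simp
      then have "h (of_nat (Suc k)) = (fdiff ^^ (2 * k + 1)) h (- of_nat k)"
        by (rule odd_central_fdiff_eq_outer_value [where h = h, OF odd, symmetric])
      also have "\<dots> = 0" using central less.prems Suc by simp
      finally show ?thesis unfolding Suc .
    qed
  qed
qed

lemma central_fdiff_falling:
  "(fdiff ^^ (2 * k + 1)) (\<lambda>x. falling (of_nat i + x) (2 * i + 1)) (- of_nat k) =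
    (if i = k then fact (2 * k + 1) else (0 :: 'a::{comm_ring_1,semiring_char_0}))"
proof -
  consider (less) "i < k" | (equal) "i = k" | (greater) "k < i" by linarith
  then show ?thesis
  proof cases
    case less
    then have "falling (of_nat (2 * i + 1)) (2 * k + 1) = (0 :: 'a)"
      by (intro falling_of_nat_eq_0) simp
    with less show ?thesis
      unfolding fdiff_funpow_falling by simp
  next
    case equal
    then show ?thesis
      unfolding fdiff_funpow_falling
      by (simp only: falling_of_nat_self diff_self_eq_0 falling_0 mult_1_right if_True refl)
  next
    case greater
    then have "falling (of_nat i + - of_nat k) (2 * i + 1 - (2 * k + 1)) = (0 :: 'a)"
      using falling_of_nat_eq_0 [of "i - k" "2 * i + 1 - (2 * k + 1)", where 'a = 'a]
      by (simp add: of_nat_diff)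
    with greater show ?thesis
      unfolding fdiff_funpow_falling by simp
  qed
qed

lemma odd_polyfun_Stirling_formula:
  fixes h :: "'a::field_char_0 \<Rightarrow> 'a"
  assumes "polyfun (2 * j + 1) h" and odd: "\<And>x. h (- x) = - h x"
  shows "h d = (\<Sum>k\<le>j. (fdiff ^^ (2 * k + 1)) h (- of_nat k) / fact (2 * k + 1) *
    (d * (\<Prod>r = 1..k. d\<^sup>2 - (of_nat r)\<^sup>2)))"
proof -
  define c where "c k = (fdiff ^^ (2 * k + 1)) h (- of_nat k) / fact (2 * k + 1)" for k
  define u where "u k x = falling (of_nat k + x) (2 * k + 1)" for k and x :: 'a
  have "(\<lambda>x. h x - (\<Sum>k\<le>j. c k * u k x)) = (\<lambda>x. 0)"
  proof (rule odd_polyfun_eq_0_if_central_fdiff_eq_0 [of j])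
    have "polyfun (2 * j + 1) (u k)" if "k \<le> j" for k
      unfolding u_def [abs_def] using that by (intro polyfun_mono [OF polyfun_falling]) simp
    then show "polyfun (2 * j + 1) (\<lambda>x. h x - (\<Sum>k\<le>j. c k * u k x))"
      by (intro polyfun_diff assms(1) polyfun_sum polyfun_scale) simp
    have "u k (- x) = - u k x" for k x
      unfolding u_def prod_square_diff_eq_falling [symmetric] by simp
    then show "h (- x) - (\<Sum>k\<le>j. c k * u k (- x)) = - (h x - (\<Sum>k\<le>j. c k * u k x))" for x
      by (simp add: odd sum_negf)
  next
    fix k assume "k \<le> j"
    have "(fdiff ^^ (2 * k + 1)) (\<lambda>x. \<Sum>i\<le>j. c i * u i x) (- of_nat k) =
        (\<Sum>i\<le>j. c i * (if i = k then fact (2 * k + 1) else 0))"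
      unfolding fdiff_funpow_sum fdiff_funpow_scale u_def central_fdiff_falling ..
    also have "\<dots> = (\<Sum>i\<le>j. if i = k then c k * fact (2 * k + 1) else 0)"
      by (intro sum.cong refl) simp
    also have "\<dots> = (fdiff ^^ (2 * k + 1)) h (- of_nat k)"
      using \<open>k \<le> j\<close> by (simp add: c_def del: fact_Suc funpow.simps)
    finally show "(fdiff ^^ (2 * k + 1)) (\<lambda>x. h x - (\<Sum>k\<le>j. c k * u k x)) (- of_nat k) = 0"
      unfolding fdiff_funpow_diff by simp
  qed
  then have "h d - (\<Sum>k\<le>j. c k * u k d) = 0" by (rule fun_cong)
  then show ?thesis
    unfolding c_def u_def prod_square_diff_eq_falling by simp
qed


section \<open>Central differences of a product of shifted squares\<close>

definition shifted_square_prod :: "nat \<Rightarrow> 'a::comm_ring_1 \<Rightarrow> 'a \<Rightarrow> 'a"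
  where "shifted_square_prod n x t = (\<Prod>i<n. x - (t - of_nat i)\<^sup>2)"

lemma falling_mult_falling:
  "falling (e + t) n * falling (e - t + (of_nat n - 1)) n = shifted_square_prod n (e\<^sup>2) t"
proof -
  have "falling (e - t + (of_nat n - 1)) n = (\<Prod>i<n. e - t + (of_nat n - 1) - of_nat (n - Suc i))"
    unfolding falling_def by (rule prod.nat_diff_reindex [symmetric])
  also have "\<dots> = (\<Prod>i<n. e - t + of_nat i)"
    by (intro prod.cong refl) (simp add: of_nat_diff algebra_simps)
  finally show ?thesis
    unfolding falling_def shifted_square_prod_def
    by (simp flip: prod.distrib) (intro prod.cong refl, simp add: algebra_simps power2_eq_square)
qed

lemma shifted_square_prod_reflect:
  "shifted_square_prod (Suc N) x (of_nat N - t) = shifted_square_prod (Suc N) x t"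
proof -
  have "shifted_square_prod (Suc N) x (of_nat N - t) =
      (\<Prod>i<Suc N. x - (of_nat N - t - of_nat (Suc N - Suc i))\<^sup>2)"
    unfolding shifted_square_prod_def by (rule prod.nat_diff_reindex [symmetric])
  also have "\<dots> = shifted_square_prod (Suc N) x t"
    unfolding shifted_square_prod_def
    by (intro prod.cong refl) (auto simp: of_nat_diff power2_commute)
  finally show ?thesis .
qed

lemma polyfun_shifted_square: "polyfun 2 (\<lambda>t. (t - c)\<^sup>2)"
  using polyfun_mult [OF polyfun_linear [of 1 "- c"] polyfun_linear [of 1 "- c"]]
  by (simp add: power2_eq_square numeral_2_eq_2)

lemma polyfun_shifted_square_prod: "polyfun (2 * n) (shifted_square_prod n x)"
proof -
  have "polyfun 2 (\<lambda>t. x - (t - of_nat i)\<^sup>2)" for i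
    by (intro polyfun_diff polyfun_const polyfun_shifted_square)
  then show ?thesis
    using polyfun_prod [of "{..<n}" 2 "\<lambda>i t. x - (t - of_nat i)\<^sup>2"]
    by (simp add: shifted_square_prod_def [abs_def])
qed

lemma shifted_square_prod_eq_0:
  assumes "k \<le> r" "2 * r \<le> n" "i < n + r + k"
  shows "shifted_square_prod n ((of_nat r)\<^sup>2) (of_nat i - of_nat k) = 0"
proof -
  obtain l where l: "l < n" "of_nat i - of_nat k - of_nat l = - (of_nat r :: 'a) \<or>
      of_nat i - of_nat k - of_nat l = (of_nat r :: 'a)"
  proof (cases "i + r - k < n")
    case True
    then show thesis using assms(1) by (intro that [of "i + r - k"]) (auto simp: of_nat_diff)
  next
    case False
    then show thesis using assms by (intro that [of "i - (k + r)"]) (auto simp: of_nat_diff)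
  qed
  then have "(of_nat r)\<^sup>2 - (of_nat i - of_nat k - of_nat l)\<^sup>2 = (0 :: 'a)"
    by auto
  with l(1) show ?thesis
    unfolding shifted_square_prod_def by (intro prod_zero) auto
qed

lemma prod_square_diff_mult_fact:
  "(\<Prod>r = k + 1..k + m. (of_nat k)\<^sup>2 - (of_nat r)\<^sup>2) * fact (2 * k) =
    ((-1) ^ m * fact m * fact (2 * k + m) :: 'a::{comm_ring_1,semiring_char_0})"
proof (induction m)
  case (Suc m)
  have "(\<Prod>r = k + 1..k + Suc m. (of_nat k)\<^sup>2 - (of_nat r)\<^sup>2) * fact (2 * k) =
     ((\<Prod>r = k + 1..k + m. (of_nat k)\<^sup>2 - (of_nat r)\<^sup>2) * fact (2 * k)) *
       ((of_nat k)\<^sup>2 - (of_nat (k + Suc m))\<^sup>2 :: 'a)"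
    by (simp add: mult_ac)
  also have "\<dots> = (-1) ^ Suc m * fact (Suc m) * fact (2 * k + Suc m)"
    unfolding Suc.IH by (simp add: algebra_simps power2_eq_square)
  finally show ?case .
qed simp

lemma prod_square_diff_eq_fact:
  assumes "k \<le> n"
  shows "(\<Prod>r = k + 1..n. (of_nat k)\<^sup>2 - (of_nat r)\<^sup>2) =
    ((-1) ^ (n - k) * fact (n - k) * fact (n + k) / fact (2 * k) :: 'a::field_char_0)"
  using prod_square_diff_mult_fact [of k "n - k", where 'a = 'a] assms
  by (simp add: field_simps mult_2)

lemma central_fdiff_shifted_square_prod_eq_0:
  assumes "k < r" "2 * r \<le> n"
  shows "(fdiff ^^ (n + 2 * k)) (shifted_square_prod n ((of_nat r)\<^sup>2)) (- of_nat k) = 0"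
  unfolding fdiff_funpow_eq_sum
  by (intro sum.neutral ballI) (use assms in \<open>simp add: shifted_square_prod_eq_0\<close>)

lemma central_fdiff_shifted_square_prod_self:
  assumes "2 * k \<le> n"
  shows "(fdiff ^^ (n + 2 * k)) (shifted_square_prod n ((of_nat k)\<^sup>2)) (- of_nat k) =
    ((-1) ^ n * fact n * fact (n + 2 * k) / fact (2 * k) :: 'a::field_char_0)"
proof -
  let ?term = "\<lambda>i. of_nat (n + 2 * k choose i) * ((-1) ^ (n + 2 * k - i) *
    shifted_square_prod n ((of_nat k)\<^sup>2) (- of_nat k + of_nat i)) :: 'a"
  have "(fdiff ^^ (n + 2 * k)) (shifted_square_prod n ((of_nat k)\<^sup>2)) (- of_nat k) =
      (\<Sum>i\<le>n + 2 * k. ?term i)"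
    by (rule fdiff_funpow_eq_sum)
  also have "\<dots> = (\<Sum>i\<in>{n + 2 * k}. ?term i)"
    using assms by (intro sum.mono_neutral_right) (auto simp: shifted_square_prod_eq_0)
  also have "\<dots> = shifted_square_prod n ((of_nat k)\<^sup>2) (of_nat (k + n))"
    by (simp add: add.commute)
  also have "\<dots> = (\<Prod>r = k + 1..k + n. (of_nat k)\<^sup>2 - (of_nat r)\<^sup>2)"
    unfolding shifted_square_prod_def
    by (rule prod.reindex_bij_witness [of _ "\<lambda>r. k + n - r" "\<lambda>i. k + n - i"])
      (auto simp: of_nat_diff)
  also have "\<dots> = (-1) ^ n * fact n * fact (n + 2 * k) / fact (2 * k)"
    by (subst prod_square_diff_eq_fact) (simp_all add: mult_2 add_ac)
  finally show ?thesis .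
qed

lemma polyfun_central_fdiff_shifted_square_prod:
  assumes "k \<le> j"
  shows "polyfun (j - k)
    (\<lambda>x. (fdiff ^^ (2 * j + 2 * k)) (shifted_square_prod (2 * j) x) t :: 'a::idom)"
proof -
  have "0 + 2 * card {..<2 * j} < 2 * j + 2 * k + 2 * Suc (j - k)"
    using assms by simp
  from polyfun_fdiff_funpow_prod_diff
    [where f = "\<lambda>_. 1" and g = "\<lambda>i t. (t - of_nat i)\<^sup>2",
      OF _ polyfun_shifted_square polyfun_const this]
  show ?thesis
    by (simp add: shifted_square_prod_def [abs_def])
qed

lemma central_fdiff_shifted_square_prod:
  assumes "k \<le> j"
  shows "(fdiff ^^ (2 * j + 2 * k)) (shifted_square_prod (2 * j) x) (- of_nat k) =
    (-1) ^ (j - k) * fact (2 * j) * fact (2 * j + 2 * k) / (fact (j - k) * fact (j + k)) *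
      (\<Prod>r = k + 1..j. x - (of_nat r)\<^sup>2 :: 'a::field_char_0)"
proof -
  let ?W = "\<lambda>x. (fdiff ^^ (2 * j + 2 * k)) (shifted_square_prod (2 * j) x) (- of_nat k) :: 'a"
  let ?c = "(-1) ^ (j - k) * fact (2 * j) * fact (2 * j + 2 * k) /
    (fact (j - k) * fact (j + k)) :: 'a"
  have "?W = (\<lambda>x. ?c * (\<Prod>r = k + 1..j. x - (of_nat r)\<^sup>2))"
  proof (rule polyfun_eqI [where m = "j - k" and A = "(\<lambda>r. (of_nat r)\<^sup>2) ` {k..j}"])
    show "polyfun (j - k) ?W"
      by (rule polyfun_central_fdiff_shifted_square_prod [OF assms])
    have "polyfun 1 (\<lambda>x. x - (of_nat r)\<^sup>2)" for r
      using polyfun_linear [of 1 "- (of_nat r)\<^sup>2"] by simp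
    from polyfun_prod [where A = "{k + 1..j}", OF finite_atLeastAtMost this]
    show "polyfun (j - k) (\<lambda>x. ?c * (\<Prod>r = k + 1..j. x - (of_nat r)\<^sup>2))"
      by (intro polyfun_scale) simp
    have "inj_on (\<lambda>r. (of_nat r :: 'a)\<^sup>2) {k..j}"
      by (intro inj_onI) (metis of_nat_eq_iff of_nat_power power2_eq_iff_nonneg zero_le)
    then show "j - k < card ((\<lambda>r. (of_nat r :: 'a)\<^sup>2) ` {k..j})"
      using assms by (simp add: card_image)
  next
    fix x :: 'a assume "x \<in> (\<lambda>r. (of_nat r)\<^sup>2) ` {k..j}"
    then consider (self) "x = (of_nat k)\<^sup>2" | (root) r where "k < r" "r \<le> j" "x = (of_nat r)\<^sup>2"
      by (auto simp: le_less)
    then show "?W x = ?c * (\<Prod>r = k + 1..j. x - (of_nat r)\<^sup>2)"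
    proof cases
      case self
      show ?thesis
        using assms unfolding self prod_square_diff_eq_fact [OF assms]
        by (subst central_fdiff_shifted_square_prod_self) simp_all
    next
      case (root r)
      then have "(\<Prod>r = k + 1..j. x - (of_nat r)\<^sup>2) = 0"
        by (intro prod_zero) auto
      with root show ?thesis
        by (simp add: central_fdiff_shifted_square_prod_eq_0)
    qed
  qed
  then show ?thesis by (rule fun_cong)
qed

lemma fdiff_shifted_square_prod_expansion:
  fixes x d :: "'a::field_char_0"
  assumes "j \<ge> 1"
  shows "(fdiff ^^ (2 * j - 1)) (shifted_square_prod (2 * j) x) d =
    (\<Sum>k\<le>j. (-1) ^ (j - k) * fact (2 * j) * fact (2 * j + 2 * k) /
        (fact (j - k) * fact (j + k) * fact (2 * k + 1)) *
      (\<Prod>r = k + 1..j. x - (of_nat r)\<^sup>2) * (d * (\<Prod>r = 1..k. d\<^sup>2 - (of_nat r)\<^sup>2)))"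
proof -
  define N where "N = 2 * j - 1"
  have N: "2 * j = Suc N" "odd N" using assms by (auto simp: N_def)
  let ?h = "(fdiff ^^ N) (shifted_square_prod (2 * j) x)"
  have "polyfun (2 * (2 * j) - N) ?h"
    by (intro polyfun_fdiff_funpow polyfun_shifted_square_prod)
  then have degree: "polyfun (2 * j + 1) ?h"
    using N(1) by simp
  have odd: "?h (- t) = - ?h t" for t
    using fdiff_funpow_reflect [where N = N and f = "shifted_square_prod (2 * j) x"] N
    by (simp add: shifted_square_prod_reflect)
  have "(fdiff ^^ (2 * k + 1)) ?h (- of_nat k) =
      (-1) ^ (j - k) * fact (2 * j) * fact (2 * j + 2 * k) / (fact (j - k) * fact (j + k)) *
        (\<Prod>r = k + 1..j. x - (of_nat r)\<^sup>2)" if "k \<le> j" for k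
  proof -
    have "(fdiff ^^ (2 * k + 1)) ?h = (fdiff ^^ (2 * k + 1 + N)) (shifted_square_prod (2 * j) x)"
      by (simp only: funpow_add comp_apply)
    also have "2 * k + 1 + N = 2 * j + 2 * k" using N(1) by simp
    finally show ?thesis
      by (simp only: central_fdiff_shifted_square_prod [OF that])
  qed
  then show ?thesis
    unfolding N_def [symmetric] odd_polyfun_Stirling_formula [OF degree odd, of d]
    by (intro sum.cong refl) (simp add: mult_ac del: fact_Suc funpow.simps)
qed


section \<open>Sums over permutations of a finite set\<close>

lemma permutes_inv_comp: "p permutes S \<Longrightarrow> q permutes T \<Longrightarrow> inv (p \<circ> q) = inv q \<circ> inv p"
  by (intro o_inv_distrib permutes_bij)

lemma permutes_comp_cancel:
  assumes "p permutes S"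
  shows "inv p \<circ> (p \<circ> f) = f" and "p \<circ> (inv p \<circ> f) = f"
  by (simp_all add: comp_assoc [symmetric] permutes_inv_o [OF assms])

lemma sign_permutes_comp:
  "finite S \<Longrightarrow> finite T \<Longrightarrow> p permutes S \<Longrightarrow> q permutes T \<Longrightarrow> sign (p \<circ> q) = sign p * sign q"
  by (meson permutes_imp_permutation sign_compose)

lemma sign_permutes_conj:
  assumes "finite S" "g permutes S" "\<sigma> permutes S"
  shows "sign (g \<circ> \<sigma> \<circ> inv g) = sign \<sigma>"
proof -
  have "sign (g \<circ> \<sigma> \<circ> inv g) = sign g * sign \<sigma> * sign (inv g)"
    using assms by (simp add: sign_permutes_comp [OF assms(1,1)] permutes_compose permutes_inv)
  also have "sign (inv g) = sign g"
    using assms by (intro sign_inverse permutes_imp_permutation)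
  also have "sign g * sign \<sigma> * sign g = sign \<sigma>"
    by (metis mult.assoc mult.commute sign_left_idempotent)
  finally show ?thesis .
qed

lemma sum_permutes_conj:
  assumes "g permutes K"
  shows "(\<Sum>\<sigma> | \<sigma> permutes K. f \<sigma>) = (\<Sum>\<sigma> | \<sigma> permutes K. f (g \<circ> \<sigma> \<circ> inv g))"
proof -
  have "(\<Sum>\<sigma> | \<sigma> permutes K. f \<sigma>) = (\<Sum>\<sigma> | \<sigma> permutes K. f (\<sigma> \<circ> inv g))"
    by (rule sum_permutations_compose_right [OF permutes_inv [OF assms]])
  also have "\<dots> = (\<Sum>\<sigma> | \<sigma> permutes K. f (g \<circ> \<sigma> \<circ> inv g))"
    by (rule setum_permutations_compose_left [OF assms])
  finally show ?thesis .
qed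

lemma sum_permutes_insert_left:
  fixes f :: "('a \<Rightarrow> 'a) \<Rightarrow> 'b::comm_monoid_add"
  assumes "finite S" "i \<notin> S"
  shows "(\<Sum>\<sigma> | \<sigma> permutes insert i S. f \<sigma>) =
    (\<Sum>\<sigma> | \<sigma> permutes S. f \<sigma>) + (\<Sum>c\<in>S. \<Sum>\<sigma> | \<sigma> permutes S. f (transpose i c \<circ> \<sigma>))"
  using assms by (simp add: sum_over_permutations_insert)

lemma sum_permutes_insert_right:
  fixes f :: "('a \<Rightarrow> 'a) \<Rightarrow> 'b::comm_monoid_add"
  assumes "finite S" "i \<notin> S"
  shows "(\<Sum>\<sigma> | \<sigma> permutes insert i S. f \<sigma>) =
    (\<Sum>\<sigma> | \<sigma> permutes S. f \<sigma>) + (\<Sum>c\<in>S. \<Sum>\<sigma> | \<sigma> permutes S. f (\<sigma> \<circ> transpose i c))"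
proof -
  have "(\<Sum>\<sigma> | \<sigma> permutes insert i S. f \<sigma>) = (\<Sum>\<sigma> | \<sigma> permutes insert i S. f (inv \<sigma>))"
    by (rule sum_permutations_inverse)
  also have "\<dots> = (\<Sum>\<sigma> | \<sigma> permutes S. f (inv \<sigma>)) +
      (\<Sum>c\<in>S. \<Sum>\<sigma> | \<sigma> permutes S. f (inv \<sigma> \<circ> transpose i c))"
    unfolding sum_permutes_insert_left [OF assms]
    by (intro arg_cong2 [of _ _ _ _ "(+)"] sum.cong refl) (simp add: o_inv_distrib permutes_bij)
  also have "\<dots> = (\<Sum>\<sigma> | \<sigma> permutes S. f \<sigma>) + (\<Sum>c\<in>S. \<Sum>\<sigma> | \<sigma> permutes S. f (\<sigma> \<circ> transpose i c))"
    unfolding sum_permutations_inverse [of "\<lambda>\<sigma>. f (\<sigma> \<circ> transpose i _)", symmetric]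
      sum_permutations_inverse [of f, symmetric] ..
  finally show ?thesis .
qed


section \<open>Functions preserved by a permutation\<close>

definition preserves :: "'a set \<Rightarrow> ('a \<Rightarrow> 'b) \<Rightarrow> ('a \<Rightarrow> 'a) \<Rightarrow> bool"
  where "preserves K f \<sigma> \<longleftrightarrow> (\<forall>x\<in>K. f (\<sigma> x) = f x)"

lemma preserves_id [simp]: "preserves K f id"
  by (simp add: preserves_def)

lemma preserves_comp_left:
  "preserves K f \<tau> \<Longrightarrow> \<sigma> permutes K \<Longrightarrow> preserves K f (\<tau> \<circ> \<sigma>) \<longleftrightarrow> preserves K f \<sigma>"
  by (simp add: preserves_def permutes_in_image)

lemma preserves_comp_right:
  assumes "preserves K f \<tau>" "\<tau> permutes K"
  shows "preserves K f (\<sigma> \<circ> \<tau>) \<longleftrightarrow> preserves K f \<sigma>"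
proof -
  have "(\<forall>x\<in>K. f (\<sigma> x) = f x) \<longleftrightarrow> (\<forall>x\<in>\<tau> ` K. f (\<sigma> x) = f x)"
    by (simp only: permutes_image [OF assms(2)])
  with assms(1) show ?thesis by (simp add: preserves_def)
qed

lemma preserves_inv:
  assumes "\<sigma> permutes K"
  shows "preserves K f (inv \<sigma>) \<longleftrightarrow> preserves K f \<sigma>"
proof -
  have "(\<forall>x\<in>K. f (inv \<sigma> x) = f x) \<longleftrightarrow> (\<forall>x\<in>\<sigma> ` K. f (inv \<sigma> x) = f x)"
    by (simp only: permutes_image [OF assms])
  then show ?thesis by (auto simp: preserves_def permutes_inverses [OF assms])
qed

lemma preserves_conj:
  assumes "g permutes K"
  shows "preserves K f (g \<circ> \<sigma> \<circ> inv g) \<longleftrightarrow> preserves K (f \<circ> g) \<sigma>"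
proof -
  have "(\<forall>x\<in>K. f (g (\<sigma> (inv g x))) = f x) \<longleftrightarrow> (\<forall>x\<in>g ` K. f (g (\<sigma> (inv g x))) = f x)"
    by (simp only: permutes_image [OF assms])
  then show ?thesis by (simp add: preserves_def permutes_inverses [OF assms])
qed

lemma preserves_subset:
  assumes "\<sigma> permutes K" "K \<subseteq> N"
  shows "preserves N f \<sigma> \<longleftrightarrow> preserves K f \<sigma>"
  using assms permutes_not_in [OF assms(1)] by (auto simp: preserves_def)

lemma preserves_cong:
  "(\<And>x. x \<in> K \<Longrightarrow> f x = g x) \<Longrightarrow> \<sigma> permutes K \<Longrightarrow> preserves K f \<sigma> \<longleftrightarrow> preserves K g \<sigma>"
  by (simp add: preserves_def permutes_in_image)

lemma preserves_transpose: "f x = f y \<Longrightarrow> preserves K f (transpose x y)"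
  by (simp add: preserves_def transpose_def)

lemma preserves_insert_comp_transpose:
  assumes "\<sigma> permutes Y" "i \<notin> Y" "c \<in> insert i Y"
  shows "preserves (insert i Y) f (\<sigma> \<circ> transpose i c) \<longleftrightarrow> f c = f i \<and> preserves Y f \<sigma>"
proof -
  have "\<sigma> i = i" using assms by (simp add: permutes_not_in)
  then have insert: "preserves (insert i Y) f \<sigma> \<longleftrightarrow> preserves Y f \<sigma>"
    by (simp add: preserves_def)
  have "preserves (insert i Y) f (\<sigma> \<circ> transpose i c) \<longleftrightarrow> preserves (insert i Y) f \<sigma>" if "f c = f i"
    using that assms by (intro preserves_comp_right preserves_transpose permutes_swap_id) auto
  moreover have "f c = f i" if "preserves (insert i Y) f (\<sigma> \<circ> transpose i c)"
    using that assms(3) \<open>\<sigma> i = i\<close> by (auto simp: preserves_def dest: bspec [of _ _ c])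
  ultimately show ?thesis using insert by blast
qed

definition colourings :: "'b set \<Rightarrow> 'a set \<Rightarrow> ('a \<Rightarrow> 'a) \<Rightarrow> ('a \<Rightarrow> 'b) set"
  where "colourings C K \<sigma> = {r \<in> K \<rightarrow>\<^sub>E C. preserves K r \<sigma>}"

lemma colourings_inv: "\<sigma> permutes K \<Longrightarrow> colourings C K (inv \<sigma>) = colourings C K \<sigma>"
  by (simp add: colourings_def preserves_inv)

lemma card_colourings_conj:
  assumes "g permutes K"
  shows "card (colourings C K (g \<circ> \<sigma> \<circ> inv g)) = card (colourings C K \<sigma>)"
proof (rule bij_betw_same_card [of "\<lambda>r. r \<circ> g"],
    rule bij_betw_byWitness [where f' = "\<lambda>r. r \<circ> inv g"])
  have comp_mem: "r \<circ> h \<in> K \<rightarrow>\<^sub>E C" if "r \<in> K \<rightarrow>\<^sub>E C" "h permutes K" for r h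
    using that permutes_in_image [OF that(2)] by (auto simp: PiE_def extensional_def Pi_def)
  show "(\<lambda>r. r \<circ> g) ` colourings C K (g \<circ> \<sigma> \<circ> inv g) \<subseteq> colourings C K \<sigma>"
    using comp_mem [OF _ assms] by (auto simp: colourings_def preserves_conj [OF assms])
  show "(\<lambda>r. r \<circ> inv g) ` colourings C K \<sigma> \<subseteq> colourings C K (g \<circ> \<sigma> \<circ> inv g)"
    using comp_mem [OF _ permutes_inv [OF assms]]
    by (auto simp: colourings_def preserves_conj [OF assms] permutes_inj [OF assms])
qed (simp_all add: comp_assoc permutes_inv_o [OF assms])

lemma card_colourings_insert_comp_transpose:
  assumes "\<sigma> permutes Y" "i \<notin> Y" "c \<in> insert i Y"
  shows "card (colourings C (insert i Y) (\<sigma> \<circ> transpose i c)) =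
    (if c = i then card C else 1) * card (colourings C Y \<sigma>)"
proof -
  let ?extensions = "{(y, r). y \<in> C \<and> r \<in> colourings C Y \<sigma> \<and> (c = i \<or> y = r c)}"
  have "preserves Y (r(i := y)) \<sigma> \<longleftrightarrow> preserves Y r \<sigma>" for r :: "'a \<Rightarrow> 'b" and y
    using assms by (intro preserves_cong) auto
  then have extends: "(r(i := y)) c = (r(i := y)) i \<and> preserves Y (r(i := y)) \<sigma> \<longleftrightarrow>
      preserves Y r \<sigma> \<and> (c = i \<or> y = r c)" for r :: "'a \<Rightarrow> 'b" and y
    by auto
  have "colourings C (insert i Y) (\<sigma> \<circ> transpose i c) = (\<lambda>(y, r). r(i := y)) `
      {(y, r). y \<in> C \<and> r \<in> Y \<rightarrow>\<^sub>E C \<and> (r(i := y)) c = (r(i := y)) i \<and> preserves Y (r(i := y)) \<sigma>}"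
    unfolding colourings_def preserves_insert_comp_transpose [OF assms] PiE_insert_eq
    by (auto simp del: fun_upd_apply)
  also have "\<dots> = (\<lambda>(y, r). r(i := y)) ` ?extensions"
    unfolding extends by (simp add: colourings_def conj_assoc)
  finally have "colourings C (insert i Y) (\<sigma> \<circ> transpose i c) =
      (\<lambda>(y, r). r(i := y)) ` ?extensions" .
  moreover have "inj_on (\<lambda>(y, r). r(i := y)) ?extensions"
    by (rule inj_on_subset [OF inj_combinator [OF assms(2), of "\<lambda>_. C"]])
      (auto simp: colourings_def)
  ultimately have "card (colourings C (insert i Y) (\<sigma> \<circ> transpose i c)) = card ?extensions"
    by (simp add: card_image)
  also have "?extensions =
      (if c = i then C \<times> colourings C Y \<sigma> else (\<lambda>r. (r c, r)) ` colourings C Y \<sigma>)"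
    using assms(3) by (auto simp: colourings_def)
  also have "card \<dots> = (if c = i then card C else 1) * card (colourings C Y \<sigma>)"
    by (simp add: card_cartesian_product card_image inj_on_def)
  finally show ?thesis .
qed

text \<open>If \<open>\<sigma>\<close> permutes \<open>K\<close> with \<open>\<kappa>\<close> cycles, then \<open>\<phi> K \<sigma> = z\<^bsup>\<kappa>\<^esup> \<epsilon>\<^bsup>|K| - \<kappa>\<^esup>\<close>.\<close>

definition cycle_weight :: "'c::comm_ring_1 \<Rightarrow> 'c \<Rightarrow> ('a set \<Rightarrow> ('a \<Rightarrow> 'a) \<Rightarrow> 'c) \<Rightarrow> bool"
  where "cycle_weight z \<epsilon> \<phi> \<longleftrightarrow> \<phi> {} id = 1 \<and>
    (\<forall>Y i c \<sigma>. finite Y \<longrightarrow> i \<notin> Y \<longrightarrow> c \<in> insert i Y \<longrightarrow> \<sigma> permutes Y \<longrightarrow>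
      \<phi> (insert i Y) (\<sigma> \<circ> transpose i c) = (if c = i then z else \<epsilon>) * \<phi> Y \<sigma>)"

lemma cycle_weight_colourings:
  "cycle_weight (of_nat (card C)) 1 (\<lambda>K \<sigma>. of_nat (card (colourings C K \<sigma>)))"
  unfolding cycle_weight_def
  by (auto simp: card_colourings_insert_comp_transpose simp del: transpose_same)
    (simp add: colourings_def preserves_def)

lemma cycle_weight_sign: "cycle_weight (1 :: 'c::comm_ring_1) (-1) (\<lambda>K \<sigma>. of_int (sign \<sigma>))"
  unfolding cycle_weight_def
proof (intro conjI allI impI)
  fix Y :: "'a set" and i c \<sigma> assume "finite Y" "\<sigma> permutes Y"
  then have "permutation \<sigma>" by (rule permutes_imp_permutation)
  then show "(of_int (sign (\<sigma> \<circ> transpose i c)) :: 'c) =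
      (if c = i then 1 else -1) * of_int (sign \<sigma>)"
    by (simp add: sign_compose permutation_swap_id sign_swap_id)
qed simp

lemma cycle_weight_mult:
  "cycle_weight z \<epsilon> \<phi> \<Longrightarrow> cycle_weight z' \<epsilon>' \<psi> \<Longrightarrow> cycle_weight (z * z') (\<epsilon> * \<epsilon>') (\<lambda>K \<sigma>. \<phi> K \<sigma> * \<psi> K \<sigma>)"
  unfolding cycle_weight_def by (simp add: mult_ac)


section \<open>Hook sums and Jucys--Murphy elements\<close>

text \<open>The pairing of \<open>F\<close> with the Young symmetrizer of a hook with column \<open>A\<close> and row \<open>B\<close>.\<close>

definition hook_sum :: "'a set \<Rightarrow> 'a set \<Rightarrow> (('a \<Rightarrow> 'a) \<Rightarrow> 'c) \<Rightarrow> 'c::comm_ring_1"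
  where "hook_sum A B F = (\<Sum>a | a permutes A. \<Sum>b | b permutes B. of_int (sign a) * F (a \<circ> b))"

lemma hook_sum_cong:
  assumes "A \<union> B \<subseteq> K" "\<And>\<tau>. \<tau> permutes K \<Longrightarrow> F \<tau> = G \<tau>"
  shows "hook_sum A B F = hook_sum A B G"
proof -
  have "F (a \<circ> b) = G (a \<circ> b)" if "a permutes A" "b permutes B" for a b
    using that assms(1)
    by (intro assms(2) permutes_compose permutes_subset [OF that(1)]
        permutes_subset [OF that(2)]) auto
  then show ?thesis
    unfolding hook_sum_def by simp
qed

lemma hook_sum_add: "hook_sum A B (\<lambda>\<tau>. F \<tau> + G \<tau>) = hook_sum A B F + hook_sum A B G"
  unfolding hook_sum_def by (simp add: distrib_left sum.distrib)

lemma hook_sum_scale: "hook_sum A B (\<lambda>\<tau>. c * F \<tau>) = c * hook_sum A B F"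
  unfolding hook_sum_def sum_distrib_left by (simp add: mult.left_commute)

lemma hook_sum_sum: "hook_sum A B (\<lambda>\<tau>. \<Sum>i\<in>I. F i \<tau>) = (\<Sum>i\<in>I. hook_sum A B (F i))"
  unfolding hook_sum_def sum_distrib_left by (simp add: sum.swap [of _ I])

lemma hook_sum_insert_left:
  assumes "finite A" "i \<notin> A"
  shows "hook_sum (insert i A) B F =
    hook_sum A B F - (\<Sum>c\<in>A. hook_sum A B (\<lambda>\<tau>. F (transpose i c \<circ> \<tau>)))"
proof -
  have sign: "sign (transpose i c \<circ> a) = - sign a" if "c \<in> A" "a permutes A" for c a
  proof -
    have "permutation a" using assms(1) that(2) by (rule permutes_imp_permutation)
    moreover have "i \<noteq> c" using that(1) assms(2) by auto
    ultimately show ?thesis by (simp add: sign_compose permutation_swap_id sign_swap_id)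
  qed
  show ?thesis
    unfolding hook_sum_def sum_permutes_insert_left [OF assms]
      diff_conv_add_uminus sum_negf [symmetric]
    by (intro arg_cong2 [of _ _ _ _ "(+)"] sum.cong refl) (simp add: sign comp_assoc)
qed

lemma hook_sum_insert_right:
  assumes "finite B" "i \<notin> B"
  shows "hook_sum A (insert i B) F =
    hook_sum A B F + (\<Sum>c\<in>B. hook_sum A B (\<lambda>\<tau>. F (\<tau> \<circ> transpose i c)))"
  unfolding hook_sum_def sum_permutes_insert_right [OF assms] sum.distrib sum.swap [of _ B]
  by (simp add: comp_assoc)

lemma hook_sum_column:
  assumes "finite A" "g permutes A"
  shows "hook_sum A B (\<lambda>\<tau>. F (g \<circ> \<tau>)) = of_int (sign g) * hook_sum A B F"
proof -
  have "hook_sum A B F =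
      (\<Sum>a | a permutes A. \<Sum>b | b permutes B. of_int (sign (g \<circ> a)) * F (g \<circ> a \<circ> b))"
    unfolding hook_sum_def by (rule setum_permutations_compose_left [OF assms(2)])
  also have "\<dots> = of_int (sign g) * hook_sum A B (\<lambda>\<tau>. F (g \<circ> \<tau>))"
    unfolding hook_sum_def sum_distrib_left
    by (intro sum.cong refl) (simp add: sign_permutes_comp [OF assms(1,1,2)] comp_assoc mult.assoc)
  finally show ?thesis
    by (simp add: mult.assoc [symmetric] flip: of_int_mult)
qed

lemma permutes_disjoint_commute:
  assumes "a permutes A" "g permutes C" "A \<inter> C = {}"
  shows "a \<circ> g = g \<circ> a"
proof
  fix x
  have "a x \<in> A \<longleftrightarrow> x \<in> A" "g x \<in> C \<longleftrightarrow> x \<in> C" using assms by (simp_all add: permutes_in_image)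
  then show "(a \<circ> g) x = (g \<circ> a) x"
    using assms permutes_not_in [OF assms(1)] permutes_not_in [OF assms(2)]
    by (cases "x \<in> A"; cases "x \<in> C") fastforce+
qed

lemma hook_sum_row:
  assumes "g permutes B - A"
  shows "hook_sum A B (\<lambda>\<tau>. F (g \<circ> \<tau>)) = hook_sum A B F"
  unfolding hook_sum_def
proof (rule sum.cong [OF refl])
  fix a assume "a \<in> {a. a permutes A}"
  then have "a \<circ> g = g \<circ> a"
    using assms by (intro permutes_disjoint_commute [of a A g "B - A"]) auto
  then have commute: "g \<circ> (a \<circ> b) = a \<circ> (g \<circ> b)" for b :: "'a \<Rightarrow> 'a"
    by (metis comp_assoc)
  have "g permutes B" using assms by (rule permutes_subset) blast
  then have "(\<Sum>b | b permutes B. of_int (sign a) * F (a \<circ> b)) =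
      (\<Sum>b | b permutes B. of_int (sign a) * F (a \<circ> (g \<circ> b)))"
    by (rule setum_permutations_compose_left)
  then show "(\<Sum>b | b permutes B. of_int (sign a) * F (g \<circ> (a \<circ> b))) =
      (\<Sum>b | b permutes B. of_int (sign a) * F (a \<circ> b))"
    unfolding commute by simp
qed

lemma hook_sum_eq_0:
  fixes F :: "('a \<Rightarrow> 'a) \<Rightarrow> 'c::{idom,ring_char_0}"
  assumes "finite A" "x \<in> A \<inter> B" "y \<in> A \<inter> B" "x \<noteq> y"
  shows "hook_sum A B F = 0"
proof -
  let ?t = "transpose x y"
  have t: "?t permutes A" "?t permutes B" using assms by (auto intro: permutes_swap_id)
  have "hook_sum A B F =
      (\<Sum>a | a permutes A. \<Sum>b | b permutes B. of_int (sign (a \<circ> ?t)) * F (a \<circ> ?t \<circ> b))"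
    unfolding hook_sum_def by (rule sum_permutations_compose_right [OF t(1)])
  also have "\<dots> =
      (\<Sum>a | a permutes A. \<Sum>b | b permutes B. of_int (sign (a \<circ> ?t)) * F (a \<circ> ?t \<circ> (?t \<circ> b)))"
    by (intro sum.cong refl setum_permutations_compose_left t(2))
  also have "\<dots> = - hook_sum A B F"
    unfolding hook_sum_def sum_negf [symmetric]
  proof (intro sum.cong refl)
    fix a b :: "'a \<Rightarrow> 'a" assume "a \<in> {a. a permutes A}"
    then have "sign (a \<circ> ?t) = - sign a"
      using assms t by (simp add: sign_permutes_comp [of A A] sign_swap_id)
    moreover have "a \<circ> ?t \<circ> (?t \<circ> b) = a \<circ> b"
      by (simp add: fun_eq_iff)
    ultimately show "of_int (sign (a \<circ> ?t)) * F (a \<circ> ?t \<circ> (?t \<circ> b)) =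
        - (of_int (sign a) * F (a \<circ> b))"
      by simp
  qed
  finally show ?thesis by simp
qed

lemma hook_sum_garnir:
  fixes F :: "('a \<Rightarrow> 'a) \<Rightarrow> 'c::{idom,ring_char_0}"
  assumes "finite A" "x \<in> A \<inter> B" "i \<in> B - A"
  shows "(\<Sum>c\<in>A. hook_sum A B (\<lambda>\<tau>. F (transpose i c \<circ> \<tau>))) = hook_sum A B F"
proof -
  have "hook_sum (insert i A) B F = 0"
    using assms by (intro hook_sum_eq_0 [where x = x and y = i]) auto
  with assms show ?thesis by (simp add: hook_sum_insert_left)
qed

lemma hook_sum_indicator_id:
  assumes "finite A" "finite B" "A \<inter> B = {x}"
  shows "hook_sum A B (\<lambda>\<tau>. if \<tau> = id then 1 else 0) = 1"
proof -
  have "a \<circ> b = id \<longleftrightarrow> a = id \<and> b = id" if ab: "a permutes A" "b permutes B" for a b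
  proof
    assume comp: "a \<circ> b = id"
    then have "a = inv b"
      using ab(2) by (metis comp_assoc comp_id id_comp permutes_inv_o(1))
    then have "a permutes B" using ab(2) by (simp add: permutes_inv)
    then have "a y = y" if "y \<in> A - {x}" for y
      using that assms(3) permutes_not_in by fastforce
    then have "a permutes {x}" using ab(1) by (rule permutes_superset [rotated])
    then have "a = id" by simp
    with comp show "a = id \<and> b = id" by simp
  qed simp
  then have "hook_sum A B (\<lambda>\<tau>. if \<tau> = id then 1 else 0) =
      (\<Sum>a | a permutes A. if a = id then \<Sum>b | b permutes B. if b = id then 1 else 0 else 0)"
    unfolding hook_sum_def by (intro sum.cong refl) (auto intro!: sum.cong)
  then show ?thesis
    using assms by (simp add: finite_permutations)
qed

lemma sum_cycle_weight_insert:
  assumes \<phi>: "cycle_weight z \<epsilon> \<phi>" and Y: "finite Y" "i \<notin> Y"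
    and eigen: "\<And>G. (\<Sum>c\<in>Y. H (\<lambda>\<tau>. G (transpose i c \<circ> \<tau>))) = \<kappa> * H G"
  shows "(\<Sum>\<sigma> | \<sigma> permutes insert i Y. \<phi> (insert i Y) \<sigma> * H (\<lambda>\<tau>. F (\<sigma> \<circ> \<tau>))) =
    (z + \<epsilon> * \<kappa>) * (\<Sum>\<sigma> | \<sigma> permutes Y. \<phi> Y \<sigma> * H (\<lambda>\<tau>. F (\<sigma> \<circ> \<tau>)))"
proof -
  have weight: "\<phi> (insert i Y) (\<sigma> \<circ> transpose i c) = (if c = i then z else \<epsilon>) * \<phi> Y \<sigma>"
    if "c \<in> insert i Y" "\<sigma> permutes Y" for c \<sigma>
    using \<phi> Y that unfolding cycle_weight_def by blast
  have "(\<Sum>c\<in>Y. \<phi> (insert i Y) (\<sigma> \<circ> transpose i c) * H (\<lambda>\<tau>. F (\<sigma> \<circ> transpose i c \<circ> \<tau>))) =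
      \<epsilon> * \<kappa> * (\<phi> Y \<sigma> * H (\<lambda>\<tau>. F (\<sigma> \<circ> \<tau>)))" if "\<sigma> permutes Y" for \<sigma>
  proof -
    have "(\<Sum>c\<in>Y. \<phi> (insert i Y) (\<sigma> \<circ> transpose i c) * H (\<lambda>\<tau>. F (\<sigma> \<circ> transpose i c \<circ> \<tau>))) =
        \<epsilon> * \<phi> Y \<sigma> * (\<Sum>c\<in>Y. H (\<lambda>\<tau>. F (\<sigma> \<circ> (transpose i c \<circ> \<tau>))))"
      unfolding sum_distrib_left using that Y(2)
      by (intro sum.cong refl) (auto simp: weight comp_assoc)
    then show ?thesis
      unfolding eigen [of "\<lambda>\<tau>. F (\<sigma> \<circ> \<tau>)"] by (simp add: mult_ac)
  qed
  moreover have "\<phi> (insert i Y) \<sigma> = z * \<phi> Y \<sigma>" if "\<sigma> permutes Y" for \<sigma>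
    using weight [of i \<sigma>] that by simp
  ultimately show ?thesis
    unfolding sum_permutes_insert_right [OF Y] sum.swap [of _ _ Y]
      sum.distrib [symmetric] sum_distrib_left
    by (intro sum.cong refl) (simp add: distrib_right mult.assoc)
qed

lemma sum_cycle_weight_hook_sum_column:
  fixes z :: "'c::comm_ring_1"
  assumes \<phi>: "cycle_weight z \<epsilon> \<phi>" and "finite A" "finite Y" "Y \<subseteq> A"
  shows "(\<Sum>\<sigma> | \<sigma> permutes Y. \<phi> Y \<sigma> * hook_sum A B (\<lambda>\<tau>. F (\<sigma> \<circ> \<tau>))) =
    (\<Prod>l<card Y. z - \<epsilon> * of_nat l) * hook_sum A B F"
  using assms(3,4)
proof (induction Y)
  case empty
  then show ?case
    using \<phi> by (simp add: cycle_weight_def id_def)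
next
  case (insert i Y)
  have "(\<Sum>\<sigma> | \<sigma> permutes insert i Y. \<phi> (insert i Y) \<sigma> * hook_sum A B (\<lambda>\<tau>. F (\<sigma> \<circ> \<tau>))) =
      (z + \<epsilon> * (- of_nat (card Y))) * (\<Sum>\<sigma> | \<sigma> permutes Y. \<phi> Y \<sigma> * hook_sum A B (\<lambda>\<tau>. F (\<sigma> \<circ> \<tau>)))"
  proof (rule sum_cycle_weight_insert [OF \<phi> insert.hyps(1,2)])
    fix G :: "('a \<Rightarrow> 'a) \<Rightarrow> 'c"
    have "hook_sum A B (\<lambda>\<tau>. G (transpose i c \<circ> \<tau>)) = - hook_sum A B G" if "c \<in> Y" for c
    proof -
      have "transpose i c permutes A" "i \<noteq> c"
        using that insert.prems insert.hyps by (auto intro: permutes_swap_id)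
      then show ?thesis
        by (simp add: hook_sum_column [OF \<open>finite A\<close>] sign_swap_id)
    qed
    then show "(\<Sum>c\<in>Y. hook_sum A B (\<lambda>\<tau>. G (transpose i c \<circ> \<tau>))) =
        - of_nat (card Y) * hook_sum A B G"
      by simp
  qed
  with insert show ?case by (simp add: comp_def mult.left_commute)
qed

lemma sum_cycle_weight_hook_sum:
  fixes z :: "'c::{idom,ring_char_0}"
  assumes \<phi>: "cycle_weight z \<epsilon> \<phi>" and A: "finite A" "x \<in> A \<inter> B" and R: "finite R" "R \<subseteq> B - A"
  shows "(\<Sum>\<sigma> | \<sigma> permutes A \<union> R. \<phi> (A \<union> R) \<sigma> * hook_sum A B (\<lambda>\<tau>. F (\<sigma> \<circ> \<tau>))) =
    (\<Prod>l<card R. z + \<epsilon> * of_nat (l + 1)) * (\<Prod>l<card A. z - \<epsilon> * of_nat l) * hook_sum A B F"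
  using R
proof (induction R)
  case empty
  show ?case
    using sum_cycle_weight_hook_sum_column [OF \<phi> A(1) A(1) subset_refl]
    by (simp only: Un_empty_right card.empty lessThan_0 prod.empty mult_1)
next
  case (insert i R)
  have i: "i \<notin> A \<union> R" "i \<in> B - A" and fin: "finite (A \<union> R)" and disjoint: "A \<inter> R = {}"
    using insert A by auto
  have "(\<Sum>\<sigma> | \<sigma> permutes insert i (A \<union> R). \<phi> (insert i (A \<union> R)) \<sigma> * hook_sum A B (\<lambda>\<tau>. F (\<sigma> \<circ> \<tau>))) =
      (z + \<epsilon> * of_nat (card R + 1)) *
        (\<Sum>\<sigma> | \<sigma> permutes A \<union> R. \<phi> (A \<union> R) \<sigma> * hook_sum A B (\<lambda>\<tau>. F (\<sigma> \<circ> \<tau>)))"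
  proof (rule sum_cycle_weight_insert [OF \<phi> fin i(1)])
    fix G :: "('a \<Rightarrow> 'a) \<Rightarrow> 'c"
    have "hook_sum A B (\<lambda>\<tau>. G (transpose i c \<circ> \<tau>)) = hook_sum A B G" if "c \<in> R" for c
      using that insert.prems i by (intro hook_sum_row permutes_swap_id) auto
    then show "(\<Sum>c\<in>A \<union> R. hook_sum A B (\<lambda>\<tau>. G (transpose i c \<circ> \<tau>))) =
        of_nat (card R + 1) * hook_sum A B G"
      using A(1) insert.hyps disjoint
      by (simp add: sum.union_disjoint hook_sum_garnir [OF A i(2)] algebra_simps)
  qed
  with insert show ?case by (simp add: comp_def mult_ac)
qed


section \<open>Class functions on cycles as alternating hook sums\<close>

lemma cyclic_on_insert_remove:
  assumes w: "w permutes insert i Y" "cyclic_on w (insert i Y)" and Y: "i \<notin> Y" "Y \<noteq> {}"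
  obtains b w' where "b \<in> Y" "w' permutes Y" "cyclic_on w' Y" "w = w' \<circ> transpose i b"
proof -
  define b where "b = inv w i"
  define w' where "w' = w \<circ> transpose i b"
  have b: "w b = i" using w(1) by (simp add: b_def permutes_inverses)
  have orbit_i: "orbit w i = insert i Y" using w(2) by (intro orbit_cyclic_eq3) auto
  then have "w i \<noteq> i" using Y orbit_eq_singleton_iff [of w i] by auto
  then have "b \<noteq> i" using b by auto
  moreover have "b \<in> insert i Y" using b permutes_in_image [OF w(1), of b] by simp
  ultimately have "b \<in> Y" by simp
  have w'_apply: "w' i = i" "w' b = w i" "x \<noteq> i \<Longrightarrow> x \<noteq> b \<Longrightarrow> w' x = w x" for x
    using b by (auto simp: w'_def)
  have "w' permutes insert i Y"
    unfolding w'_def using \<open>b \<in> Y\<close> by (intro permutes_compose [OF _ w(1)] permutes_swap_id) auto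
  then have "w' permutes Y"
    by (rule permutes_superset) (use w'_apply(1) in auto)
  have "y = i \<or> y \<in> orbit w' b" if "y \<in> orbit w i" for y
    using that
  proof induction
    case base
    show ?case using orbit.base [of w' b] w'_apply(2) by simp
  next
    case (step y)
    then consider "y = i" | "y = b" | "y \<noteq> i" "y \<noteq> b" "y \<in> orbit w' b" by blast
    then show ?case
      using orbit.base [of w' b] orbit.step [of y w' b] w'_apply b by cases auto
  qed
  then have "Y \<subseteq> orbit w' b" using orbit_i Y(1) by auto
  moreover have "orbit w' b \<subseteq> Y" using \<open>w' permutes Y\<close> \<open>b \<in> Y\<close> by (rule permutes_orbit_subset)
  ultimately have "cyclic_on w' Y" using \<open>b \<in> Y\<close> by (intro cyclic_on_singleI) auto
  moreover have "w = w' \<circ> transpose i b" by (simp add: w'_def comp_assoc)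
  ultimately show thesis using that \<open>b \<in> Y\<close> \<open>w' permutes Y\<close> by blast
qed

definition conj_invariant :: "'a set \<Rightarrow> 'a set \<Rightarrow> (('a \<Rightarrow> 'a) \<Rightarrow> 'c) \<Rightarrow> bool"
  where "conj_invariant X K F \<longleftrightarrow>
    (\<forall>g \<sigma>. g permutes X \<longrightarrow> \<sigma> permutes K \<longrightarrow> F (g \<circ> \<sigma> \<circ> inv g) = F \<sigma>)"

lemma conj_invariantD:
  "conj_invariant X K F \<Longrightarrow> g permutes X \<Longrightarrow> \<sigma> permutes K \<Longrightarrow> F (g \<circ> \<sigma> \<circ> inv g) = F \<sigma>"
  by (simp add: conj_invariant_def)

lemma conj_invariant_subset: "conj_invariant K K F \<Longrightarrow> X \<subseteq> K \<Longrightarrow> conj_invariant X K F"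
  unfolding conj_invariant_def using permutes_subset by blast

lemma permutes_comp_transpose_insert:
  assumes "\<sigma> permutes K" "y \<in> K"
  shows "\<sigma> \<circ> transpose i y permutes insert i K" "transpose i y \<circ> \<sigma> permutes insert i K"
  using assms by (auto intro!: permutes_compose permutes_swap_id permutes_subset [OF assms(1)])

lemma conj_invariant_comp_transpose:
  assumes "conj_invariant X (insert i K) F" "\<sigma> permutes K" "i \<in> X" "c \<in> X" "c \<in> K"
  shows "F (transpose i c \<circ> \<sigma>) = F (\<sigma> \<circ> transpose i c)"
  using conj_invariantD
    [OF assms(1) permutes_swap_id permutes_comp_transpose_insert(1) [OF assms(2)], of i c c]
    assms(3-5)
  by (simp add: comp_assoc)

definition alternating_hook_sum :: "'a \<Rightarrow> 'a set \<Rightarrow> (('a \<Rightarrow> 'a) \<Rightarrow> 'c) \<Rightarrow> 'c::comm_ring_1"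
  where "alternating_hook_sum x X F =
    (\<Sum>S\<in>Pow X. (-1) ^ card S * hook_sum (insert x S) (insert x (X - S)) F)"

definition insertion_sum :: "'a \<Rightarrow> 'a set \<Rightarrow> 'a \<Rightarrow> (('a \<Rightarrow> 'a) \<Rightarrow> 'c) \<Rightarrow> ('a \<Rightarrow> 'a) \<Rightarrow> 'c::comm_ring_1"
  where "insertion_sum x X i F \<sigma> =
    (\<Sum>y\<in>insert x X. F (\<sigma> \<circ> transpose i y)) + F (transpose i x \<circ> \<sigma>)"

lemma hook_sum_insert_diff:
  assumes X: "finite X" "x \<notin> X" "i \<notin> insert x X" "S \<subseteq> X"
    and F: "conj_invariant (insert i X) (insert i (insert x X)) F"
  shows "hook_sum (insert x S) (insert i (insert x (X - S))) F -
      hook_sum (insert i (insert x S)) (insert x (X - S)) F =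
    hook_sum (insert x S) (insert x (X - S)) (insertion_sum x X i F)"
proof -
  let ?H = "hook_sum (insert x S) (insert x (X - S))"
  have finite: "finite S" "finite (X - S)" using X finite_subset by auto
  then have insertable: "finite (insert x S)" "i \<notin> insert x S"
    "finite (insert x (X - S))" "i \<notin> insert x (X - S)"
    using X by auto
  have "hook_sum (insert x S) (insert i (insert x (X - S))) F -
      hook_sum (insert i (insert x S)) (insert x (X - S)) F =
      (\<Sum>c\<in>insert x (X - S). ?H (\<lambda>\<tau>. F (\<tau> \<circ> transpose i c))) +
      (\<Sum>c\<in>insert x S. ?H (\<lambda>\<tau>. F (transpose i c \<circ> \<tau>)))"
    unfolding hook_sum_insert_left [OF insertable(1,2)] hook_sum_insert_right [OF insertable(3,4)]
    by (simp add: algebra_simps)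
  also have "(\<Sum>c\<in>insert x S. ?H (\<lambda>\<tau>. F (transpose i c \<circ> \<tau>))) =
      ?H (\<lambda>\<tau>. F (transpose i x \<circ> \<tau>)) + (\<Sum>c\<in>S. ?H (\<lambda>\<tau>. F (\<tau> \<circ> transpose i c)))"
  proof -
    have "?H (\<lambda>\<tau>. F (transpose i c \<circ> \<tau>)) = ?H (\<lambda>\<tau>. F (\<tau> \<circ> transpose i c))" if "c \<in> S" for c
      using that X(4)
      by (intro hook_sum_cong [where K = "insert x X"] conj_invariant_comp_transpose [OF F]) auto
    moreover have "x \<notin> S" using X by auto
    ultimately show ?thesis using finite by simp
  qed
  also have "(\<Sum>c\<in>insert x (X - S). ?H (\<lambda>\<tau>. F (\<tau> \<circ> transpose i c))) +
      (?H (\<lambda>\<tau>. F (transpose i x \<circ> \<tau>)) + (\<Sum>c\<in>S. ?H (\<lambda>\<tau>. F (\<tau> \<circ> transpose i c)))) =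
      (\<Sum>c\<in>insert x (X - S) \<union> S. ?H (\<lambda>\<tau>. F (\<tau> \<circ> transpose i c))) + ?H (\<lambda>\<tau>. F (transpose i x \<circ> \<tau>))"
    using X finite by (subst sum.union_disjoint) auto
  also have "insert x (X - S) \<union> S = insert x X" using X(4) by auto
  finally show ?thesis
    by (simp only: insertion_sum_def [abs_def] hook_sum_add hook_sum_sum)
qed

lemma alternating_hook_sum_insert:
  assumes X: "finite X" "x \<notin> X" "i \<notin> insert x X"
    and F: "conj_invariant (insert i X) (insert i (insert x X)) F"
  shows "alternating_hook_sum x (insert i X) F = alternating_hook_sum x X (insertion_sum x X i F)"
proof -
  let ?term = "\<lambda>S. (-1) ^ card S * hook_sum (insert x S) (insert x (insert i X - S)) F"
  have "alternating_hook_sum x (insert i X) F =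
      (\<Sum>S\<in>Pow X. ?term S) + (\<Sum>S\<in>insert i ` Pow X. ?term S)"
    unfolding alternating_hook_sum_def Pow_insert using X by (intro sum.union_disjoint) auto
  also have "(\<Sum>S\<in>insert i ` Pow X. ?term S) = (\<Sum>S\<in>Pow X. ?term (insert i S))"
    using X by (subst sum.reindex) (auto simp: inj_on_def)
  also have "(\<Sum>S\<in>Pow X. ?term S) + (\<Sum>S\<in>Pow X. ?term (insert i S)) =
      alternating_hook_sum x X (insertion_sum x X i F)"
    unfolding alternating_hook_sum_def sum.distrib [symmetric]
  proof (intro sum.cong refl)
    fix S assume "S \<in> Pow X"
    then have "S \<subseteq> X" by simp
    with X have "finite S" "i \<notin> S" using finite_subset by auto
    then have "card (insert i S) = Suc (card S)" by simp
    moreover have "insert x (insert i X - S) = insert i (insert x (X - S))"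
      "insert x (insert i S) = insert i (insert x S)"
      "insert x (insert i X - insert i S) = insert x (X - S)"
      using X \<open>i \<notin> S\<close> by auto
    ultimately have "?term S + ?term (insert i S) = (-1) ^ card S *
        (hook_sum (insert x S) (insert i (insert x (X - S))) F -
         hook_sum (insert i (insert x S)) (insert x (X - S)) F)"
      by (simp add: right_diff_distrib)
    then show "?term S + ?term (insert i S) =
        (-1) ^ card S * hook_sum (insert x S) (insert x (X - S)) (insertion_sum x X i F)"
      unfolding hook_sum_insert_diff [OF X \<open>S \<subseteq> X\<close> F] .
  qed
  finally show ?thesis .
qed

lemma conj_invariant_insertion_sum:
  assumes "x \<notin> X" "i \<notin> insert x X" and F: "conj_invariant (insert i X) (insert i (insert x X)) F"
  shows "conj_invariant X (insert x X) (insertion_sum x X i F)"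
  unfolding conj_invariant_def
proof (intro allI impI)
  fix g \<sigma> assume g: "g permutes X" and \<sigma>: "\<sigma> permutes insert x X"
  have g_insert: "g permutes insert i X" "g permutes insert x X"
    using g by (auto elim: permutes_subset)
  have g_fixes: "g i = i" "inv g i = i" "inv g x = x"
    using assms permutes_not_in [OF g] permutes_not_in [OF permutes_inv [OF g]] by auto
  have transpose_inv: "inv g \<circ> transpose i y = transpose i (inv g y) \<circ> inv g" for y
    using transpose_comp_eq [OF permutes_bij [OF permutes_inv [OF g]], of i "inv g y"] g_fixes
    by (simp add: permutes_inv_inv [OF g] permutes_inverses [OF g])
  have "F (g \<circ> \<sigma> \<circ> inv g \<circ> transpose i y) = F (\<sigma> \<circ> transpose i (inv g y))" if "y \<in> insert x X" for y
  proof -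
    have "inv g y \<in> insert x X"
      using that permutes_in_image [OF permutes_inv [OF g_insert(2)]] by blast
    then have "F (g \<circ> (\<sigma> \<circ> transpose i (inv g y)) \<circ> inv g) = F (\<sigma> \<circ> transpose i (inv g y))"
      by (intro conj_invariantD [OF F g_insert(1)] permutes_comp_transpose_insert(1) \<sigma>)
    then show ?thesis by (simp only: comp_assoc transpose_inv)
  qed
  then have "(\<Sum>y\<in>insert x X. F (g \<circ> \<sigma> \<circ> inv g \<circ> transpose i y)) =
      (\<Sum>y\<in>insert x X. F (\<sigma> \<circ> transpose i (inv g y)))"
    by (intro sum.cong refl)
  also have "\<dots> = (\<Sum>y\<in>insert x X. F (\<sigma> \<circ> transpose i y))"
    using sum.permute [OF permutes_inv [OF g_insert(2)], of "\<lambda>y. F (\<sigma> \<circ> transpose i y)"]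
    by (simp only: comp_def)
  moreover have "F (transpose i x \<circ> (g \<circ> \<sigma> \<circ> inv g)) = F (transpose i x \<circ> \<sigma>)"
  proof -
    have "transpose i x \<circ> g = g \<circ> transpose i x"
      using transpose_comp_eq [OF permutes_bij [OF g], of i x] g_fixes by simp
    then have "transpose i x \<circ> (g \<circ> \<sigma> \<circ> inv g) = g \<circ> (transpose i x \<circ> \<sigma>) \<circ> inv g"
      by (metis comp_assoc)
    then show ?thesis
      using conj_invariantD [OF F g_insert(1) permutes_comp_transpose_insert(2) [OF \<sigma>, of x i]]
      by simp
  qed
  ultimately show "insertion_sum x X i F (g \<circ> \<sigma> \<circ> inv g) = insertion_sum x X i F \<sigma>"
    by (simp only: insertion_sum_def)
qed

text \<open>Conjugating by \<open>transpose i (w b)\<close> moves the insertion point from \<open>b\<close> to \<open>w b\<close>, hence to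
  any point of the cycle; the point \<open>x\<close>, which may not be moved, is where the orbit starts.\<close>

lemma conj_invariant_comp_transpose_cyclic:
  assumes w: "w permutes insert x X" "cyclic_on w (insert x X)" and "i \<notin> insert x X"
    and F: "conj_invariant (insert i X) (insert i (insert x X)) F" and "y \<in> insert x X"
  shows "F (w \<circ> transpose i y) = F (w \<circ> transpose i x)"
proof -
  have "w i = i" using w(1) \<open>i \<notin> insert x X\<close> by (simp add: permutes_not_in)
  have shift: "F (w \<circ> transpose i (w b)) = F (w \<circ> transpose i b)"
    if "b \<in> insert x X" "w b \<noteq> x" for b
  proof -
    let ?t = "transpose i (w b)"
    have "w b \<in> X" using that permutes_in_image [OF w(1), of b] by simp
    have "?t \<circ> w = w \<circ> transpose i b"
      using transpose_comp_eq [OF permutes_bij [OF w(1)], of i "w b"] \<open>w i = i\<close>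
      by (metis permutes_inverses(2) [OF w(1)])
    moreover have "F (?t \<circ> w) = F (w \<circ> ?t)"
      using \<open>w b \<in> X\<close> by (intro conj_invariant_comp_transpose [OF F w(1)]) auto
    ultimately show ?thesis by simp
  qed
  have "F (w \<circ> transpose i z) = F (w \<circ> transpose i x)" if "z \<in> orbit w x" for z
    using that
  proof induction
    case base
    show ?case using shift [of x] by (cases "w x = x") (auto simp: comp_def)
  next
    case (step z)
    have "z \<in> insert x X" using permutes_orbit_subset [OF w(1)] step.hyps by blast
    then show ?case using shift [of z] step.IH by (cases "w z = x") (auto simp: comp_def)
  qed
  moreover have "orbit w x = insert x X" using w(2) by (intro orbit_cyclic_eq3) auto
  ultimately show ?thesis using \<open>y \<in> insert x X\<close> by blast
qed

lemma insertion_sum_cyclic: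
  assumes w: "w permutes insert x X" "cyclic_on w (insert x X)"
    and X: "finite X" "x \<notin> X" "i \<notin> insert x X" and b: "b \<in> insert x X"
    and F: "conj_invariant (insert i X) (insert i (insert x X)) F"
  shows "insertion_sum x X i F w = of_nat (card X + 2) * F (w \<circ> transpose i b)"
proof -
  note moved = conj_invariant_comp_transpose_cyclic [OF w X(3) F]
  have "w i = i" using w(1) X(3) by (simp add: permutes_not_in)
  then have "transpose i x \<circ> w = w \<circ> transpose i (inv w x)"
    using transpose_comp_eq [OF permutes_bij [OF w(1)], of i x]
    by (metis permutes_inverses(2) [OF w(1)])
  moreover have "inv w x \<in> insert x X"
    using permutes_in_image [OF permutes_inv [OF w(1)], of x] by simp
  ultimately have "F (transpose i x \<circ> w) = F (w \<circ> transpose i b)"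
    using moved b by metis
  moreover have "F (w \<circ> transpose i y) = F (w \<circ> transpose i b)" if "y \<in> insert x X" for y
    using moved b that by metis
  ultimately show ?thesis
    using X by (simp add: insertion_sum_def algebra_simps)
qed

text \<open>Since \<open>insertion_sum\<close> treats \<open>x\<close> specially, it is invariant only under permutations that
  fix \<open>x\<close>; the induction therefore assumes no more of \<open>F\<close>.\<close>

lemma alternating_hook_sum_cyclic:
  assumes "finite X" "x \<notin> X" "w permutes insert x X" "cyclic_on w (insert x X)"
    and "conj_invariant X (insert x X) F"
  shows "alternating_hook_sum x X F = fact (card X + 1) * F w"
  using assms
proof (induction X arbitrary: F w)
  case empty
  then show ?case
    by (simp add: alternating_hook_sum_def hook_sum_def id_def)
next
  case (insert i X)
  have x: "x \<notin> X" and i: "i \<notin> insert x X" using insert by auto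
  have F: "conj_invariant (insert i X) (insert i (insert x X)) F"
    using insert.prems by (simp add: insert_commute)
  obtain b w' where b: "b \<in> insert x X" and w': "w' permutes insert x X" "cyclic_on w' (insert x X)"
    and w: "w = w' \<circ> transpose i b"
    using cyclic_on_insert_remove [of w i "insert x X"] insert.prems i
    by (auto simp: insert_commute)
  have "alternating_hook_sum x (insert i X) F = alternating_hook_sum x X (insertion_sum x X i F)"
    by (rule alternating_hook_sum_insert [OF insert.hyps(1) x i F])
  also have "\<dots> = fact (card X + 1) * insertion_sum x X i F w'"
    by (rule insert.IH [OF x w' conj_invariant_insertion_sum [OF x i F]])
  also have "\<dots> = fact (card X + 1) * (of_nat (card X + 2) * F w)"
    unfolding w insertion_sum_cyclic [OF w' insert.hyps(1) x i b F] ..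
  finally show ?case
    using insert.hyps by (simp add: mult_ac)
qed


section \<open>Convolution of functions on permutations\<close>

definition convolution ::
    "'a set \<Rightarrow> (('a \<Rightarrow> 'a) \<Rightarrow> 'c) \<Rightarrow> (('a \<Rightarrow> 'a) \<Rightarrow> 'c) \<Rightarrow> ('a \<Rightarrow> 'a) \<Rightarrow> 'c::comm_ring_1"
  where "convolution K \<phi> \<psi> w = (\<Sum>\<sigma> | \<sigma> permutes K. \<phi> \<sigma> * \<psi> (inv \<sigma> \<circ> w))"

lemma convolution_cong:
  assumes "w permutes K" "\<And>\<sigma>. \<sigma> permutes K \<Longrightarrow> \<phi> \<sigma> = \<phi>' \<sigma>" "\<And>\<sigma>. \<sigma> permutes K \<Longrightarrow> \<psi> \<sigma> = \<psi>' \<sigma>"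
  shows "convolution K \<phi> \<psi> w = convolution K \<phi>' \<psi>' w"
  unfolding convolution_def using assms
  by (intro sum.cong refl) (simp add: permutes_compose permutes_inv)

lemma convolution_conj:
  assumes g: "g permutes K"
  shows "convolution K \<phi> \<psi> (g \<circ> w \<circ> inv g) =
    convolution K (\<lambda>\<sigma>. \<phi> (g \<circ> \<sigma> \<circ> inv g)) (\<lambda>\<sigma>. \<psi> (g \<circ> \<sigma> \<circ> inv g)) w"
proof -
  have "inv (g \<circ> \<sigma> \<circ> inv g) \<circ> (g \<circ> w \<circ> inv g) = g \<circ> (inv \<sigma> \<circ> w) \<circ> inv g" if \<sigma>: "\<sigma> permutes K" for \<sigma>
  proof -
    have "inv (g \<circ> \<sigma> \<circ> inv g) = g \<circ> inv \<sigma> \<circ> inv g"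
      using permutes_inv_comp [OF permutes_compose [OF \<sigma> g] permutes_inv [OF g]]
        permutes_inv_comp [OF g \<sigma>] permutes_inv_inv [OF g] by (simp add: comp_assoc)
    then show ?thesis
      by (simp add: comp_assoc permutes_comp_cancel [OF g])
  qed
  then show ?thesis
    unfolding convolution_def by (subst sum_permutes_conj [OF g]) simp
qed

lemma conj_invariant_convolution:
  assumes "conj_invariant K K \<phi>" "conj_invariant K K \<psi>"
  shows "conj_invariant K K (convolution K \<phi> \<psi>)"
  unfolding conj_invariant_def
  by (auto simp: convolution_conj assms [THEN conj_invariantD] intro!: convolution_cong)

lemma convolution_assoc:
  assumes "w permutes K"
  shows "convolution K (convolution K \<phi> \<psi>) \<chi> w = convolution K \<phi> (convolution K \<psi> \<chi>) w"
proof -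
  have "convolution K (convolution K \<phi> \<psi>) \<chi> w =
      (\<Sum>\<rho> | \<rho> permutes K. \<Sum>\<sigma> | \<sigma> permutes K. \<phi> \<sigma> * (\<psi> (inv \<sigma> \<circ> \<rho>) * \<chi> (inv \<rho> \<circ> w)))"
    unfolding convolution_def sum_distrib_right by (simp add: mult.assoc)
  also have "\<dots> = (\<Sum>\<sigma> | \<sigma> permutes K. \<Sum>\<rho> | \<rho> permutes K. \<phi> \<sigma> * (\<psi> (inv \<sigma> \<circ> \<rho>) * \<chi> (inv \<rho> \<circ> w)))"
    by (rule sum.swap)
  also have "\<dots> = convolution K \<phi> (convolution K \<psi> \<chi>) w"
    unfolding convolution_def [of K \<phi>]
  proof (rule sum.cong [OF refl])
    fix \<sigma> assume "\<sigma> \<in> {\<sigma>. \<sigma> permutes K}"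
    then have \<sigma>: "\<sigma> permutes K" by simp
    have "(\<Sum>\<rho> | \<rho> permutes K. \<phi> \<sigma> * (\<psi> (inv \<sigma> \<circ> \<rho>) * \<chi> (inv \<rho> \<circ> w))) =
        (\<Sum>\<rho> | \<rho> permutes K. \<phi> \<sigma> * (\<psi> (inv \<sigma> \<circ> (\<sigma> \<circ> \<rho>)) * \<chi> (inv (\<sigma> \<circ> \<rho>) \<circ> w)))"
      by (rule setum_permutations_compose_left [OF \<sigma>])
    also have "\<dots> = \<phi> \<sigma> * convolution K \<psi> \<chi> (inv \<sigma> \<circ> w)"
      unfolding convolution_def sum_distrib_left
      by (intro sum.cong refl)
        (simp add: permutes_comp_cancel [OF \<sigma>] permutes_inv_comp [OF \<sigma>] comp_assoc)
    finally show "(\<Sum>\<rho> | \<rho> permutes K. \<phi> \<sigma> * (\<psi> (inv \<sigma> \<circ> \<rho>) * \<chi> (inv \<rho> \<circ> w))) =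
      \<phi> \<sigma> * convolution K \<psi> \<chi> (inv \<sigma> \<circ> w)" .
  qed
  finally show ?thesis .
qed

lemma convolution_comp_left:
  assumes "u permutes K" "\<And>\<sigma>. \<sigma> permutes K \<Longrightarrow> \<phi> (u \<circ> \<sigma>) = \<phi> \<sigma>"
  shows "convolution K \<phi> \<psi> (u \<circ> w) = convolution K \<phi> \<psi> w"
proof -
  have "convolution K \<phi> \<psi> (u \<circ> w) =
      (\<Sum>\<sigma> | \<sigma> permutes K. \<phi> (u \<circ> \<sigma>) * \<psi> (inv (u \<circ> \<sigma>) \<circ> (u \<circ> w)))"
    unfolding convolution_def by (rule setum_permutations_compose_left [OF assms(1)])
  also have "\<dots> = convolution K \<phi> \<psi> w"
    unfolding convolution_def
    by (intro sum.cong refl)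
      (simp add: assms(2) permutes_inv_comp [OF assms(1)] comp_assoc
        permutes_comp_cancel [OF assms(1)])
  finally show ?thesis .
qed

lemma convolution_comp_right:
  assumes "w permutes K" "\<And>\<sigma>. \<sigma> permutes K \<Longrightarrow> \<psi> (\<sigma> \<circ> v) = c * \<psi> \<sigma>"
  shows "convolution K \<phi> \<psi> (w \<circ> v) = c * convolution K \<phi> \<psi> w"
  unfolding convolution_def sum_distrib_left
  using assms
  by (intro sum.cong refl)
    (simp add: comp_assoc [symmetric] permutes_compose permutes_inv mult.left_commute)

lemma convolution_eq_0:
  fixes \<phi> :: "('a \<Rightarrow> 'a) \<Rightarrow> 'c::{idom,ring_char_0}"
  assumes "t permutes K" "\<And>\<sigma>. \<sigma> permutes K \<Longrightarrow> \<phi> (\<sigma> \<circ> inv t) = \<phi> \<sigma>"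
    "\<And>\<sigma>. \<sigma> permutes K \<Longrightarrow> \<psi> (t \<circ> \<sigma>) = - \<psi> \<sigma>" "w permutes K"
  shows "convolution K \<phi> \<psi> w = 0"
proof -
  have "convolution K \<phi> \<psi> w =
      (\<Sum>\<sigma> | \<sigma> permutes K. \<phi> (\<sigma> \<circ> inv t) * \<psi> (inv (\<sigma> \<circ> inv t) \<circ> w))"
    unfolding convolution_def
    by (rule sum_permutations_compose_right [OF permutes_inv [OF assms(1)]])
  also have "\<dots> = - convolution K \<phi> \<psi> w"
    unfolding convolution_def sum_negf [symmetric]
  proof (intro sum.cong refl)
    fix \<sigma> assume "\<sigma> \<in> {\<sigma>. \<sigma> permutes K}"
    then have \<sigma>: "\<sigma> permutes K" by simp
    have "inv (\<sigma> \<circ> inv t) \<circ> w = t \<circ> (inv \<sigma> \<circ> w)"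
      using permutes_inv_comp [OF \<sigma> permutes_inv [OF assms(1)]] permutes_inv_inv [OF assms(1)]
      by (simp add: comp_assoc)
    then show "\<phi> (\<sigma> \<circ> inv t) * \<psi> (inv (\<sigma> \<circ> inv t) \<circ> w) = - (\<phi> \<sigma> * \<psi> (inv \<sigma> \<circ> w))"
      using assms \<sigma> by (simp add: permutes_compose permutes_inv)
  qed
  finally show ?thesis by simp
qed


section \<open>Factorizations of a cycle weighted by colourings\<close>

text \<open>The contents of the boxes of a hook are \<open>0, -1, \<dots>\<close> down its column and \<open>1, 2, \<dots>\<close> along
  the rest of its row.\<close>

definition hook_content_product :: "'c::comm_ring_1 \<Rightarrow> 'c \<Rightarrow> nat \<Rightarrow> nat \<Rightarrow> 'c"
  where "hook_content_product z \<epsilon> m r = (\<Prod>l<r. z + \<epsilon> * of_nat (l + 1)) * (\<Prod>l<m. z - \<epsilon> * of_nat l)"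

lemma hook_content_product_1: "hook_content_product z 1 m r = falling (z + of_nat r) (r + m)"
proof (induction r)
  case (Suc r)
  have "falling (z + of_nat (Suc r)) (Suc r + m) =
      (z + of_nat r + 1) * falling (z + of_nat r) (r + m)"
    using falling_Suc_shift [of "z + of_nat r" "r + m"] by (simp add: add_ac)
  also have "\<dots> = (z + of_nat r + 1) * hook_content_product z 1 m r"
    by (simp only: Suc)
  finally show ?case by (simp add: hook_content_product_def mult_ac add_ac)
qed (simp add: hook_content_product_def falling_def)

lemma hook_content_product_minus_1:
  "hook_content_product z (-1) m r = falling (z - 1 + of_nat m) (m + r)"
proof -
  have "hook_content_product z (-1) m r = hook_content_product (z - 1) 1 r m"
    by (simp add: hook_content_product_def algebra_simps)
  then show ?thesis by (simp only: hook_content_product_1)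
qed

lemma hook_sum_convolution:
  fixes z :: "'c::{idom,ring_char_0}"
  assumes \<phi>: "cycle_weight z \<epsilon> \<phi>" and inv: "\<And>\<sigma>. \<sigma> permutes K \<Longrightarrow> \<phi> K (inv \<sigma>) = \<phi> K \<sigma>"
    and K: "finite K" "A \<union> B = K" "x \<in> A \<inter> B"
  shows "hook_sum A B (convolution K (\<phi> K) G) =
    hook_content_product z \<epsilon> (card A) (card (B - A)) * hook_sum A B G"
proof -
  have finite: "finite A" "finite (B - A)" and union: "A \<union> (B - A) = K"
    using K by auto
  have "hook_sum A B (convolution K (\<phi> K) G) =
      (\<Sum>\<sigma> | \<sigma> permutes K. \<phi> K \<sigma> * hook_sum A B (\<lambda>\<tau>. G (inv \<sigma> \<circ> \<tau>)))"
    unfolding convolution_def [abs_def] hook_sum_sum hook_sum_scale ..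
  also have "\<dots> = (\<Sum>\<sigma> | \<sigma> permutes K. \<phi> K (inv \<sigma>) * hook_sum A B (\<lambda>\<tau>. G (inv (inv \<sigma>) \<circ> \<tau>)))"
    by (rule sum_permutations_inverse)
  also have "\<dots> = (\<Sum>\<sigma> | \<sigma> permutes K. \<phi> K \<sigma> * hook_sum A B (\<lambda>\<tau>. G (\<sigma> \<circ> \<tau>)))"
    by (intro sum.cong refl) (simp add: inv permutes_inv_inv)
  also have "\<dots> = hook_content_product z \<epsilon> (card A) (card (B - A)) * hook_sum A B G"
    using sum_cycle_weight_hook_sum [OF \<phi> finite(1) K(3) finite(2) subset_refl, of G]
    unfolding union hook_content_product_def .
  finally show ?thesis .
qed

lemma hook_sum_cycle_weight:
  fixes z :: "'c::{idom,ring_char_0}"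
  assumes \<phi>: "cycle_weight z \<epsilon> \<phi>" and inv: "\<And>\<sigma>. \<sigma> permutes K \<Longrightarrow> \<phi> K (inv \<sigma>) = \<phi> K \<sigma>"
    and K: "finite K" "A \<union> B = K" "A \<inter> B = {x}"
  shows "hook_sum A B (\<phi> K) = hook_content_product z \<epsilon> (card A) (card (B - A))"
proof -
  define \<delta> :: "('a \<Rightarrow> 'a) \<Rightarrow> 'c" where "\<delta> \<tau> = (if \<tau> = id then 1 else 0)" for \<tau>
  have "convolution K (\<phi> K) \<delta> w = \<phi> K w" if w: "w permutes K" for w
  proof -
    have "inv \<sigma> \<circ> w = id \<longleftrightarrow> \<sigma> = w" if \<sigma>: "\<sigma> permutes K" for \<sigma>
    proof
      assume "inv \<sigma> \<circ> w = id"
      then have "\<sigma> \<circ> id = w" using permutes_comp_cancel(2) [OF \<sigma>, of w] by simp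
      then show "\<sigma> = w" by simp
    qed (use permutes_inv_o(2) [OF \<sigma>] in auto)
    then have "convolution K (\<phi> K) \<delta> w = (\<Sum>\<sigma> | \<sigma> permutes K. if \<sigma> = w then \<phi> K \<sigma> else 0)"
      unfolding convolution_def by (intro sum.cong refl) (simp add: \<delta>_def)
    then show ?thesis
      using w K(1) by (simp add: finite_permutations)
  qed
  then have "hook_sum A B (\<phi> K) = hook_sum A B (convolution K (\<phi> K) \<delta>)"
    using K by (intro hook_sum_cong [where K = K]) auto
  also have "\<dots> = hook_content_product z \<epsilon> (card A) (card (B - A)) * hook_sum A B \<delta>"
    by (rule hook_sum_convolution [where x = x, OF \<phi> _ K(1,2)]) (use K inv in simp_all)
  also have "hook_sum A B \<delta> = 1"
    unfolding \<delta>_def [abs_def] using K by (intro hook_sum_indicator_id) auto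
  finally show ?thesis by simp
qed

text \<open>In the notation of the paper, the sum of the signs of \<open>\<sigma>\<^sub>2\<close> times
  \<open>|C|\<^bsup>\<kappa>(\<sigma>\<^sub>1)\<^esup> |D|\<^bsup>\<kappa>(\<sigma>\<^sub>2)\<^esup>\<close> over the factorizations \<open>\<sigma>\<^sub>1 \<sigma>\<^sub>2 = w\<close>.\<close>

definition factorization_sum :: "'b set \<Rightarrow> 'c set \<Rightarrow> 'a set \<Rightarrow> ('a \<Rightarrow> 'a) \<Rightarrow> complex"
  where "factorization_sum C D K =
    convolution K (\<lambda>\<sigma>. of_nat (card (colourings C K \<sigma>)))
      (\<lambda>\<sigma>. of_int (sign \<sigma>) * of_nat (card (colourings D K \<sigma>)))"

lemma conj_invariant_factorization_sum:
  "finite K \<Longrightarrow> conj_invariant K K (factorization_sum C D K)"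
  unfolding factorization_sum_def
  by (intro conj_invariant_convolution)
    (simp_all add: conj_invariant_def card_colourings_conj sign_permutes_conj)

lemma hook_sum_factorization_sum:
  assumes "finite K" "A \<union> B = K" "A \<inter> B = {x}"
  shows "hook_sum A B (factorization_sum C D K) =
    falling (of_nat (card C) + of_nat (card (B - A))) (card K) *
    falling (of_nat (card D) - 1 + of_nat (card A)) (card K)"
proof -
  have "card (A \<union> (B - A)) = card A + card (B - A)"
    using assms by (intro card_Un_disjoint) auto
  also have "A \<union> (B - A) = K" using assms(2) by auto
  finally have card: "card A + card (B - A) = card K" ..
  have weight: "cycle_weight (of_nat (card D)) (-1)
      (\<lambda>(K :: 'a set) \<sigma>. of_int (sign \<sigma>) * of_nat (card (colourings D K \<sigma>)) :: complex)"
    using cycle_weight_mult [OF cycle_weight_sign cycle_weight_colourings] by simp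
  have sign_inv: "sign (inv \<sigma>) = sign \<sigma>" if "\<sigma> permutes K" for \<sigma>
    using that assms(1) by (intro sign_inverse permutes_imp_permutation)
  have "hook_sum A B (factorization_sum C D K) =
      hook_content_product (of_nat (card C)) 1 (card A) (card (B - A)) *
      hook_sum A B (\<lambda>\<sigma>. of_int (sign \<sigma>) * of_nat (card (colourings D K \<sigma>)))"
    unfolding factorization_sum_def
    by (rule hook_sum_convolution [where x = x, OF cycle_weight_colourings _ assms(1,2)])
      (use assms in \<open>simp_all add: colourings_inv\<close>)
  also have "hook_sum A B (\<lambda>\<sigma>. of_int (sign \<sigma>) * of_nat (card (colourings D K \<sigma>))) =
      hook_content_product (of_nat (card D) :: complex) (-1) (card A) (card (B - A))"
    by (rule hook_sum_cycle_weight [OF weight _ assms]) (simp add: colourings_inv sign_inv)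
  finally show ?thesis
    using card by (simp add: hook_content_product_1 hook_content_product_minus_1 add.commute)
qed

lemma hook_sum_factorization_sum_subset:
  assumes X: "finite X" "x \<notin> X" and S: "S \<subseteq> X"
  shows "hook_sum (insert x S) (insert x (X - S)) (factorization_sum C D (insert x X)) =
    falling (of_nat (card C) + of_nat (card X - card S)) (Suc (card X)) *
    falling (of_nat (card D) + of_nat (card S)) (Suc (card X))"
proof -
  have "finite S" "x \<notin> S" using X S finite_subset by auto
  have "hook_sum (insert x S) (insert x (X - S)) (factorization_sum C D (insert x X)) =
      falling (of_nat (card C) + of_nat (card (insert x (X - S) - insert x S)))
        (card (insert x X)) *
      falling (of_nat (card D) - 1 + of_nat (card (insert x S))) (card (insert x X))"
    by (rule hook_sum_factorization_sum) (use X S in auto)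
  also have "insert x (X - S) - insert x S = X - S" using X(2) by auto
  finally show ?thesis
    using \<open>finite S\<close> \<open>x \<notin> S\<close> X S by (simp add: card_Diff_subset)
qed

lemma sum_Pow_card:
  fixes f :: "nat \<Rightarrow> 'b::comm_semiring_1"
  assumes "finite X"
  shows "(\<Sum>S\<in>Pow X. f (card S)) = (\<Sum>m\<le>card X. of_nat (card X choose m) * f m)"
proof -
  have "(\<Sum>S\<in>Pow X. f (card S)) = (\<Sum>m\<le>card X. \<Sum>S\<in>{S \<in> Pow X. card S = m}. f (card S))"
    using assms by (subst sum.group) (auto intro: card_mono)
  also have "\<dots> = (\<Sum>m\<le>card X. of_nat (card X choose m) * f m)"
    using n_subsets [OF assms] by (intro sum.cong refl) simp
  finally show ?thesis .
qed

lemma factorization_sum_cyclic: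
  assumes "card K = Suc n" "w permutes K" "cyclic_on w K"
  shows "fact (Suc n) * factorization_sum C D K w =
    (\<Sum>m\<le>n. of_nat (n choose m) * ((-1) ^ m *
      (falling (of_nat (card C) + of_nat (n - m)) (Suc n) *
       falling (of_nat (card D) + of_nat m) (Suc n))))"
proof -
  have "finite K" using assms(1) by (intro card_ge_0_finite) simp
  obtain x where "x \<in> K" using assms(1) by fastforce
  define X where "X = K - {x}"
  have X: "finite X" "x \<notin> X" "insert x X = K" "card X = n"
    using \<open>finite K\<close> \<open>x \<in> K\<close> assms(1) by (auto simp: X_def)
  have "alternating_hook_sum x X (factorization_sum C D K) = (\<Sum>S\<in>Pow X. (-1) ^ card S *
      (falling (of_nat (card C) + of_nat (n - card S)) (Suc n) *
       falling (of_nat (card D) + of_nat (card S)) (Suc n)))"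
    unfolding alternating_hook_sum_def
    using hook_sum_factorization_sum_subset [OF X(1,2), of _ C D]
    by (intro sum.cong refl) (simp add: X(3,4))
  moreover have "alternating_hook_sum x X (factorization_sum C D K) =
      fact (card X + 1) * factorization_sum C D K w"
  proof (rule alternating_hook_sum_cyclic [OF X(1,2)])
    show "conj_invariant X (insert x X) (factorization_sum C D K)"
      using X(3) conj_invariant_subset [OF conj_invariant_factorization_sum [OF \<open>finite K\<close>]]
      by blast
  qed (use X(3) assms in auto)
  ultimately show ?thesis
    using sum_Pow_card [OF X(1), of "\<lambda>m. (-1) ^ m *
      (falling (of_nat (card C) + of_nat (n - m)) (Suc n) *
       falling (of_nat (card D) + of_nat m) (Suc n))"]
    by (simp only: X(4) Suc_eq_plus1)
qed


section \<open>Rows and columns of a placement\<close>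

definition row_indicator :: "'a set \<Rightarrow> ('a \<Rightarrow> 'b \<times> 'c) \<Rightarrow> ('a \<Rightarrow> 'a) \<Rightarrow> complex"
  where "row_indicator K f \<sigma> = (if preserves K (fst \<circ> f) \<sigma> then 1 else 0)"

definition column_sign :: "'a set \<Rightarrow> ('a \<Rightarrow> 'b \<times> 'c) \<Rightarrow> ('a \<Rightarrow> 'a) \<Rightarrow> complex"
  where "column_sign K f \<sigma> = (if preserves K (snd \<circ> f) \<sigma> then of_int (sign \<sigma>) else 0)"

text \<open>The Young symmetrizer of the tableau with the entry \<open>x \<in> K\<close> in row \<open>fst (f x)\<close> and column
  \<open>snd (f x)\<close>; \<open>f\<close> need not be injective.\<close>

definition young_coeff :: "'a set \<Rightarrow> ('a \<Rightarrow> 'b \<times> 'c) \<Rightarrow> ('a \<Rightarrow> 'a) \<Rightarrow> complex"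
  where "young_coeff K f = convolution K (row_indicator K f) (column_sign K f)"

lemma young_coeff_conj:
  assumes "finite K" "g permutes K" "w permutes K"
  shows "young_coeff K f (g \<circ> w \<circ> inv g) = young_coeff K (f \<circ> g) w"
  unfolding young_coeff_def convolution_conj [OF assms(2)]
  by (rule convolution_cong [OF assms(3)])
    (simp_all add: row_indicator_def column_sign_def preserves_conj [OF assms(2)]
      sign_permutes_conj [OF assms(1,2)] o_assoc)

lemma young_coeff_cong:
  assumes "\<And>x. x \<in> K \<Longrightarrow> f x = g x" "w permutes K"
  shows "young_coeff K f w = young_coeff K g w"
  unfolding young_coeff_def using assms(1)
  by (intro convolution_cong [OF assms(2)])
    (simp_all add: row_indicator_def column_sign_def preserves_cong [of K "fst \<circ> f" "fst \<circ> g"]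
      preserves_cong [of K "snd \<circ> f" "snd \<circ> g"])

lemma young_coeff_not_inj:
  assumes "finite K" "w permutes K" "\<not> inj_on f K"
  shows "young_coeff K f w = 0"
proof -
  obtain x y where xy: "x \<in> K" "y \<in> K" "x \<noteq> y" "f x = f y"
    using assms(3) by (auto simp: inj_on_def)
  let ?t = "transpose x y"
  have t: "?t permutes K" using xy by (intro permutes_swap_id)
  have row: "preserves K (fst \<circ> f) ?t" and column: "preserves K (snd \<circ> f) ?t"
    using xy by (auto intro: preserves_transpose)
  show ?thesis
    unfolding young_coeff_def
  proof (rule convolution_eq_0 [OF t _ _ assms(2)])
    fix \<sigma> assume \<sigma>: "\<sigma> permutes K"
    show "row_indicator K f (\<sigma> \<circ> inv ?t) = row_indicator K f \<sigma>"
      using preserves_comp_right [OF row t] by (simp add: row_indicator_def)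
    have "sign (?t \<circ> \<sigma>) = - sign \<sigma>"
      using sign_permutes_comp [OF assms(1,1) t \<sigma>] xy(3) by (simp add: sign_swap_id)
    then show "column_sign K f (?t \<circ> \<sigma>) = - column_sign K f \<sigma>"
      using preserves_comp_left [OF column \<sigma>] by (simp add: column_sign_def)
  qed
qed

text \<open>Where \<open>w\<close> moves nothing, the row and the column factor of \<open>w\<close> cannot move anything either.\<close>

lemma young_coeff_subset:
  assumes "finite N" "inj_on f N" "w permutes K" "K \<subseteq> N"
  shows "young_coeff N f w = young_coeff K f w"
proof -
  have "\<sigma> permutes K" if \<sigma>: "\<sigma> permutes N" and row: "preserves N (fst \<circ> f) \<sigma>"
    and column: "preserves N (snd \<circ> f) (inv \<sigma> \<circ> w)" for \<sigma>
  proof (rule permutes_superset [OF \<sigma>])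
    fix x assume x: "x \<in> N - K"
    then have "w x = x" using permutes_not_in [OF assms(3)] by simp
    then have "snd (f (inv \<sigma> x)) = snd (f x)"
      using column x by (auto simp: preserves_def dest: bspec [of _ _ x])
    moreover have "fst (f (inv \<sigma> x)) = fst (f x)"
      using row x preserves_inv [OF \<sigma>, of "fst \<circ> f"] by (simp add: preserves_def)
    ultimately have "inv \<sigma> x = x"
      using assms(2) x permutes_in_image [OF permutes_inv [OF \<sigma>], of x]
      by (auto intro: inj_onD prod_eqI)
    then show "\<sigma> x = x" by (metis permutes_inverses(1) [OF \<sigma>])
  qed
  then have "young_coeff N f w =
      (\<Sum>\<sigma> | \<sigma> permutes K. row_indicator N f \<sigma> * column_sign N f (inv \<sigma> \<circ> w))"
    unfolding young_coeff_def convolution_def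
    using assms(1,4) by (intro sum.mono_neutral_right)
      (auto simp: finite_permutations row_indicator_def column_sign_def elim: permutes_subset)
  also have "\<dots> = young_coeff K f w"
    unfolding young_coeff_def convolution_def
    using assms(3,4)
    by (intro sum.cong refl)
      (simp add: row_indicator_def column_sign_def permutes_compose permutes_inv
        preserves_subset [of _ K N])
  finally show ?thesis .
qed

lemma card_colourings_Times:
  assumes "\<sigma> permutes K" "\<tau> permutes K"
  shows "card {f \<in> K \<rightarrow>\<^sub>E C \<times> D. preserves K (fst \<circ> f) \<sigma> \<and> preserves K (snd \<circ> f) \<tau>} =
    card (colourings C K \<sigma>) * card (colourings D K \<tau>)"
proof -
  have mem: "\<sigma> x \<in> K" "\<tau> x \<in> K" if "x \<in> K" for x
    using assms that permutes_in_image by metis+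
  have "bij_betw (\<lambda>f. (restrict (fst \<circ> f) K, restrict (snd \<circ> f) K))
    {f \<in> K \<rightarrow>\<^sub>E C \<times> D. preserves K (fst \<circ> f) \<sigma> \<and> preserves K (snd \<circ> f) \<tau>}
    (colourings C K \<sigma> \<times> colourings D K \<tau>)"
    by (rule bij_betw_byWitness [where f' = "\<lambda>(r, s). restrict (\<lambda>x. (r x, s x)) K"])
      (auto simp: colourings_def preserves_def mem fun_eq_iff PiE_def extensional_def Pi_def
        mem_Times_iff)
  then show ?thesis
    unfolding card_cartesian_product [symmetric] by (rule bij_betw_same_card)
qed

lemma sum_young_coeff:
  assumes "finite K" "finite C" "finite D" "w permutes K"
  shows "(\<Sum>f\<in>K \<rightarrow>\<^sub>E C \<times> D. young_coeff K f w) = factorization_sum C D K w"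
proof -
  have fin: "finite (K \<rightarrow>\<^sub>E C \<times> D)" using assms by (intro finite_PiE) auto
  have "(\<Sum>f\<in>K \<rightarrow>\<^sub>E C \<times> D. young_coeff K f w) = (\<Sum>\<sigma> | \<sigma> permutes K. \<Sum>f\<in>K \<rightarrow>\<^sub>E C \<times> D.
      row_indicator K f \<sigma> * column_sign K f (inv \<sigma> \<circ> w))"
    unfolding young_coeff_def convolution_def by (rule sum.swap)
  also have "\<dots> = factorization_sum C D K w"
    unfolding factorization_sum_def convolution_def
  proof (rule sum.cong [OF refl])
    fix \<sigma> assume "\<sigma> \<in> {\<sigma>. \<sigma> permutes K}"
    then have \<sigma>: "\<sigma> permutes K" and \<tau>: "inv \<sigma> \<circ> w permutes K"
      using assms(4) by (auto intro: permutes_compose permutes_inv)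
    have "(\<Sum>f\<in>K \<rightarrow>\<^sub>E C \<times> D. row_indicator K f \<sigma> * column_sign K f (inv \<sigma> \<circ> w)) =
        (\<Sum>f\<in>{f \<in> K \<rightarrow>\<^sub>E C \<times> D. preserves K (fst \<circ> f) \<sigma> \<and> preserves K (snd \<circ> f) (inv \<sigma> \<circ> w)}.
          of_int (sign (inv \<sigma> \<circ> w)))"
      using fin unfolding row_indicator_def column_sign_def
      by (subst sum.inter_filter) (auto intro!: sum.cong)
    then show "(\<Sum>f\<in>K \<rightarrow>\<^sub>E C \<times> D. row_indicator K f \<sigma> * column_sign K f (inv \<sigma> \<circ> w)) =
        of_nat (card (colourings C K \<sigma>)) *
        (of_int (sign (inv \<sigma> \<circ> w)) * of_nat (card (colourings D K (inv \<sigma> \<circ> w))))"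
      by (simp add: card_colourings_Times [OF \<sigma> \<tau>])
  qed
  finally show ?thesis .
qed

lemma inj_on_extends_to_permutation:
  assumes "finite N" "K \<subseteq> N" "inj_on h K" "h ` K \<subseteq> N"
  obtains g where "g permutes N" "\<And>x. x \<in> K \<Longrightarrow> g x = h x"
proof -
  have finite: "finite K" using assms(1,2) finite_subset by auto
  then have "card (N - K) = card (N - h ` K)"
    using assms by (simp add: card_Diff_subset card_image)
  then obtain h' where h': "bij_betw h' (N - K) (N - h ` K)"
    using assms(1) finite_same_card_bij by (metis finite_Diff)
  define g where "g x = (if x \<in> K then h x else if x \<in> N then h' x else x)" for x
  have "bij_betw g (K \<union> (N - K)) (h ` K \<union> (N - h ` K))"
  proof (rule bij_betw_combine)
    show "bij_betw g K (h ` K)"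
      using assms(3) by (subst bij_betw_cong [of K g h]) (auto simp: g_def bij_betw_def)
    show "bij_betw g (N - K) (N - h ` K)"
      using h' by (subst bij_betw_cong [of "N - K" g h']) (auto simp: g_def)
  qed auto
  moreover have "K \<union> (N - K) = N" "h ` K \<union> (N - h ` K) = N"
    using assms by auto
  ultimately have "g permutes N"
    using assms(2) by (intro bij_imp_permutes) (auto simp: g_def)
  then show thesis
    by (rule that) (simp add: g_def)
qed

lemma card_permutes_agreeing:
  assumes "finite N" "K \<subseteq> N" "g permutes N"
  shows "card {h. h permutes N \<and> (\<forall>x\<in>K. h x = g x)} = fact (card N - card K)"
proof -
  have "bij_betw (\<lambda>h. g \<circ> h) {h. h permutes N - K} {h. h permutes N \<and> (\<forall>x\<in>K. h x = g x)}"
  proof (rule bij_betw_byWitness [where f' = "\<lambda>h. inv g \<circ> h"])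
    show "(\<lambda>h. g \<circ> h) ` {h. h permutes N - K} \<subseteq> {h. h permutes N \<and> (\<forall>x\<in>K. h x = g x)}"
    proof (intro image_subsetI CollectI conjI ballI)
      fix h x assume "h \<in> {h. h permutes N - K}"
      then have h: "h permutes N - K" by simp
      show "g \<circ> h permutes N"
        by (intro permutes_compose [OF _ assms(3)] permutes_subset [OF h]) auto
      show "(g \<circ> h) x = g x" if "x \<in> K"
        using that permutes_not_in [OF h, of x] by simp
    qed
    show "(\<lambda>h. inv g \<circ> h) ` {h. h permutes N \<and> (\<forall>x\<in>K. h x = g x)} \<subseteq> {h. h permutes N - K}"
    proof (intro image_subsetI CollectI)
      fix h assume "h \<in> {h. h permutes N \<and> (\<forall>x\<in>K. h x = g x)}"
      then have h: "h permutes N" "\<And>x. x \<in> K \<Longrightarrow> h x = g x" by auto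
      have "inv g \<circ> h permutes N"
        using h(1) assms(3) by (intro permutes_compose permutes_inv)
      then show "inv g \<circ> h permutes N - K"
        by (rule permutes_superset) (use h(2) in \<open>auto simp: permutes_inverses [OF assms(3)]\<close>)
    qed
  qed (simp_all add: permutes_comp_cancel [OF assms(3)])
  then have "card {h. h permutes N \<and> (\<forall>x\<in>K. h x = g x)} = card {h. h permutes N - K}"
    by (rule bij_betw_same_card [symmetric])
  also have "\<dots> = fact (card N - card K)"
    using assms(1,2) finite_subset [OF assms(2,1)]
    by (subst card_permutations [OF refl]) (auto simp: card_Diff_subset)
  finally show ?thesis .
qed

lemma card_permutes_restrict_eq:
  assumes "finite N" "K \<subseteq> N" and f: "bij_betw f N Z" and h: "h \<in> K \<rightarrow>\<^sub>E Z" "inj_on h K"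
  shows "card {g. g permutes N \<and> restrict (f \<circ> g) K = h} = fact (card N - card K)"
proof -
  let ?h = "inv_into N f \<circ> h"
  have h_lift: "f (?h x) = h x" "?h x \<in> N" if "x \<in> K" for x
    using PiE_mem [OF h(1) that] f by (simp_all add: bij_betw_def f_inv_into_f inv_into_into)
  moreover from this have "inj_on ?h K"
    by (intro inj_onI) (metis h(2) inj_onD)
  ultimately obtain g where g: "g permutes N" "\<And>x. x \<in> K \<Longrightarrow> g x = ?h x"
    using inj_on_extends_to_permutation [OF assms(1,2), of ?h] by blast
  have "restrict (f \<circ> g') K = h \<longleftrightarrow> (\<forall>x\<in>K. g' x = g x)" if g': "g' permutes N" for g'
  proof -
    have "restrict (f \<circ> g') K = h \<longleftrightarrow> (\<forall>x\<in>K. f (g' x) = f (g x))"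
      using h(1) g(2) h_lift(1)
      by (auto simp: fun_eq_iff restrict_def PiE_def extensional_def)
    moreover have "f (g' x) = f (g x) \<longleftrightarrow> g' x = g x" if "x \<in> K" for x
      using that f assms(2) permutes_in_image [OF g', of x] permutes_in_image [OF g(1), of x]
      by (auto simp: bij_betw_def inj_on_eq_iff)
    ultimately show ?thesis by simp
  qed
  then have "{g. g permutes N \<and> restrict (f \<circ> g) K = h} = {g'. g' permutes N \<and> (\<forall>x\<in>K. g' x = g x)}"
    by auto
  then show ?thesis using card_permutes_agreeing [OF assms(1,2) g(1)] by simp
qed

lemma sum_permutes_restrict:
  fixes \<phi> :: "('a \<Rightarrow> 'b) \<Rightarrow> 'c::comm_semiring_1"
  assumes "finite N" "K \<subseteq> N" and f: "bij_betw f N Z"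
  shows "(\<Sum>g | g permutes N. \<phi> (restrict (f \<circ> g) K)) =
    of_nat (fact (card N - card K)) * (\<Sum>h | h \<in> K \<rightarrow>\<^sub>E Z \<and> inj_on h K. \<phi> h)"
proof -
  let ?I = "{h. h \<in> K \<rightarrow>\<^sub>E Z \<and> inj_on h K}"
  have "finite K" "finite Z"
    using assms(1,2) bij_betw_finite [OF f] finite_subset by auto
  then have "finite ?I" by (intro finite_subset [OF _ finite_PiE [of K "\<lambda>_. Z"]]) auto
  have "restrict (f \<circ> g) K \<in> ?I" if g: "g permutes N" for g
  proof -
    have "g ` K \<subseteq> N" using assms(2) permutes_image [OF g] by blast
    then have "inj_on (f \<circ> g) K" "(f \<circ> g) ` K \<subseteq> Z"
      using f
      by (auto simp: bij_betw_def intro!: comp_inj_on permutes_inj_on [OF g] intro: inj_on_subset)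
    then show ?thesis by (auto simp: inj_on_def)
  qed
  then have "(\<lambda>g. restrict (f \<circ> g) K) ` {g. g permutes N} \<subseteq> ?I" by blast
  then have "(\<Sum>g | g permutes N. \<phi> (restrict (f \<circ> g) K)) =
      (\<Sum>h\<in>?I. \<Sum>g\<in>{g \<in> {g. g permutes N}. restrict (f \<circ> g) K = h}. \<phi> (restrict (f \<circ> g) K))"
    by (intro sum.group [symmetric] finite_permutations assms(1) \<open>finite ?I\<close>)
  also have "\<dots> = (\<Sum>h\<in>?I. of_nat (fact (card N - card K)) * \<phi> h)"
    by (intro sum.cong refl) (simp add: card_permutes_restrict_eq [OF assms])
  finally show ?thesis by (simp add: sum_distrib_left)
qed

lemma sum_young_coeff_conj:
  assumes "finite N" "bij_betw f N (C \<times> D)" "finite C" "finite D" "K \<subseteq> N" "w permutes K"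
  shows "(\<Sum>g | g permutes N. young_coeff N f (g \<circ> w \<circ> inv g)) =
    fact (card N - card K) * factorization_sum C D K w"
proof -
  have "finite K" using assms(1,5) finite_subset by auto
  have "young_coeff N f (g \<circ> w \<circ> inv g) = young_coeff K (restrict (f \<circ> g) K) w"
    if g: "g permutes N" for g
  proof -
    have "inj_on (f \<circ> g) N"
      using assms(2)
      by (auto simp: bij_betw_def permutes_image [OF g] intro: comp_inj_on permutes_inj_on [OF g])
    then have "young_coeff N (f \<circ> g) w = young_coeff K (f \<circ> g) w"
      by (intro young_coeff_subset assms)
    then show ?thesis
      using young_coeff_conj [OF assms(1) g permutes_subset [OF assms(6,5)], of f]
        young_coeff_cong [OF _ assms(6), of "f \<circ> g" "restrict (f \<circ> g) K"] by simp
  qed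
  then have "(\<Sum>g | g permutes N. young_coeff N f (g \<circ> w \<circ> inv g)) =
      fact (card N - card K) * (\<Sum>h | h \<in> K \<rightarrow>\<^sub>E C \<times> D \<and> inj_on h K. young_coeff K h w)"
    using sum_permutes_restrict [OF assms(1,5,2), of "\<lambda>h. young_coeff K h w"] by simp
  also have "(\<Sum>h | h \<in> K \<rightarrow>\<^sub>E C \<times> D \<and> inj_on h K. young_coeff K h w) =
      (\<Sum>h\<in>K \<rightarrow>\<^sub>E C \<times> D. young_coeff K h w)"
    using young_coeff_not_inj [OF \<open>finite K\<close> assms(6)] \<open>finite K\<close> assms(3,4)
    by (intro sum.mono_neutral_left) (auto intro: finite_PiE)
  also have "\<dots> = factorization_sum C D K w"
    by (rule sum_young_coeff [OF \<open>finite K\<close> assms(3,4,6)])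
  finally show ?thesis .
qed


section \<open>The Young symmetrizer of a rectangular tableau\<close>

definition young_covariant :: "'a set \<Rightarrow> ('a \<Rightarrow> 'b \<times> 'c) \<Rightarrow> (('a \<Rightarrow> 'a) \<Rightarrow> complex) \<Rightarrow> bool"
  where "young_covariant N f y \<longleftrightarrow>
    (\<forall>u \<sigma>. u permutes N \<longrightarrow> preserves N (fst \<circ> f) u \<longrightarrow> \<sigma> permutes N \<longrightarrow> y (u \<circ> \<sigma>) = y \<sigma>) \<and>
    (\<forall>v \<sigma>. v permutes N \<longrightarrow> preserves N (snd \<circ> f) v \<longrightarrow> \<sigma> permutes N \<longrightarrow>
      y (\<sigma> \<circ> v) = of_int (sign v) * y \<sigma>)"

lemma young_covariant_row:
  "young_covariant N f y \<Longrightarrow> u permutes N \<Longrightarrow> preserves N (fst \<circ> f) u \<Longrightarrow> \<sigma> permutes N \<Longrightarrow>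
    y (u \<circ> \<sigma>) = y \<sigma>"
  by (simp add: young_covariant_def)

lemma young_covariant_column:
  "young_covariant N f y \<Longrightarrow> v permutes N \<Longrightarrow> preserves N (snd \<circ> f) v \<Longrightarrow> \<sigma> permutes N \<Longrightarrow>
    y (\<sigma> \<circ> v) = of_int (sign v) * y \<sigma>"
  by (simp add: young_covariant_def)

lemma young_covariant_convolution:
  assumes "\<And>u \<sigma>. u permutes N \<Longrightarrow> preserves N (fst \<circ> f) u \<Longrightarrow> \<sigma> permutes N \<Longrightarrow> \<phi> (u \<circ> \<sigma>) = \<phi> \<sigma>"
    and "\<And>v \<sigma>. v permutes N \<Longrightarrow> preserves N (snd \<circ> f) v \<Longrightarrow> \<sigma> permutes N \<Longrightarrow>
      \<psi> (\<sigma> \<circ> v) = of_int (sign v) * \<psi> \<sigma>"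
  shows "young_covariant N f (convolution N \<phi> \<psi>)"
  unfolding young_covariant_def
  by (intro conjI allI impI convolution_comp_left convolution_comp_right assms)

lemma young_covariant_young_coeff:
  assumes "finite N"
  shows "young_covariant N f (young_coeff N f)"
  unfolding young_coeff_def
proof (rule young_covariant_convolution)
  fix u \<sigma> assume "preserves N (fst \<circ> f) u" "\<sigma> permutes N"
  then show "row_indicator N f (u \<circ> \<sigma>) = row_indicator N f \<sigma>"
    by (simp add: row_indicator_def preserves_comp_left)
next
  fix v \<sigma> assume "v permutes N" "preserves N (snd \<circ> f) v" "\<sigma> permutes N"
  then show "column_sign N f (\<sigma> \<circ> v) = of_int (sign v) * column_sign N f \<sigma>"
    using assms by (simp add: column_sign_def preserves_comp_right sign_permutes_comp)
qed

lemma young_coeff_id: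
  assumes "finite N" "inj_on f N"
  shows "young_coeff N f id = 1"
proof -
  have "row_indicator N f \<sigma> * column_sign N f (inv \<sigma> \<circ> id) = (if \<sigma> = id then 1 else 0)"
    if \<sigma>: "\<sigma> permutes N" for \<sigma>
  proof -
    have "\<sigma> = id" if "preserves N (fst \<circ> f) \<sigma>" "preserves N (snd \<circ> f) \<sigma>"
    proof
      fix x
      show "\<sigma> x = id x"
      proof (cases "x \<in> N")
        case True
        then have "f (\<sigma> x) = f x" using that by (auto simp: preserves_def intro: prod_eqI)
        then show ?thesis
          using assms(2) True permutes_in_image [OF \<sigma>, of x] by (auto dest: inj_onD)
      qed (simp add: permutes_not_in [OF \<sigma>])
    qed
    then show ?thesis
      by (auto simp: row_indicator_def column_sign_def preserves_inv [OF \<sigma>])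
  qed
  then have "young_coeff N f id = (\<Sum>\<sigma> | \<sigma> permutes N. if \<sigma> = id then 1 else 0)"
    unfolding young_coeff_def convolution_def by (intro sum.cong refl) simp
  then show ?thesis
    using assms(1) by (simp add: finite_permutations)
qed

text \<open>If no two entries of a row land in the same column under \<open>\<tau>\<close>, each row meets each column
  exactly once, so that the entries can be sorted within their rows.\<close>

lemma row_sorting_permutation:
  assumes "finite N" and f: "bij_betw f N (I \<times> J)" and \<tau>: "\<tau> permutes N"
    and separated: "\<And>a b. a \<in> N \<Longrightarrow> b \<in> N \<Longrightarrow> fst (f a) = fst (f b) \<Longrightarrow>
      snd (f (\<tau> a)) = snd (f (\<tau> b)) \<Longrightarrow> a = b"
  obtains u where "u permutes N" "\<And>m. m \<in> N \<Longrightarrow> f (u m) = (fst (f m), snd (f (\<tau> m)))"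
proof -
  define u where "u m = (if m \<in> N then inv_into N f (fst (f m), snd (f (\<tau> m))) else m)" for m
  have u: "f (u m) = (fst (f m), snd (f (\<tau> m)))" "u m \<in> N" if "m \<in> N" for m
  proof -
    have "f m \<in> I \<times> J" "f (\<tau> m) \<in> I \<times> J"
      using that bij_betwE [OF f] permutes_in_image [OF \<tau>] by blast+
    then have "(fst (f m), snd (f (\<tau> m))) \<in> f ` N"
      using f by (simp add: bij_betw_def mem_Times_iff)
    then show "f (u m) = (fst (f m), snd (f (\<tau> m)))" "u m \<in> N"
      using that by (simp_all add: u_def f_inv_into_f inv_into_into)
  qed
  have "inj_on u N"
    using separated u(1) by (intro inj_onI) (metis Pair_inject)
  then have "u permutes N"
    using assms(1) u(2) by (intro inj_imp_permutes) (auto simp: u_def)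
  with u(1) show thesis by (rule that [rotated])
qed

lemma rectangle_dichotomy:
  assumes N: "finite N" and f: "bij_betw f N (I \<times> J)" and \<sigma>: "\<sigma> permutes N"
  obtains u v where "u permutes N" "preserves N (fst \<circ> f) u"
      "v permutes N" "preserves N (snd \<circ> f) v" "\<sigma> = u \<circ> v"
  | t v where "t permutes N" "preserves N (fst \<circ> f) t"
      "v permutes N" "preserves N (snd \<circ> f) v" "sign v = -1" "t \<circ> \<sigma> = \<sigma> \<circ> v"
proof (cases "\<exists>a\<in>N. \<exists>b\<in>N. a \<noteq> b \<and> fst (f a) = fst (f b) \<and> snd (f (inv \<sigma> a)) = snd (f (inv \<sigma> b))")
  case True
  then obtain a b where ab: "a \<in> N" "b \<in> N" "a \<noteq> b" "fst (f a) = fst (f b)"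
    "snd (f (inv \<sigma> a)) = snd (f (inv \<sigma> b))"
    by blast
  have "transpose a b permutes N" "transpose (inv \<sigma> a) (inv \<sigma> b) permutes N"
    using ab permutes_in_image [OF permutes_inv [OF \<sigma>]] by (auto intro: permutes_swap_id)
  moreover have "sign (transpose (inv \<sigma> a) (inv \<sigma> b)) = -1"
    using ab(3) permutes_inverses(1) [OF \<sigma>] by (metis sign_swap_id)
  ultimately show thesis
    using ab(4,5) transpose_comp_eq [OF permutes_bij [OF \<sigma>], of a b]
    by (intro that(2) [of "transpose a b" "transpose (inv \<sigma> a) (inv \<sigma> b)"]
        preserves_transpose) simp_all
next
  case False
  then obtain u where up: "u permutes N"
    and u: "\<And>m. m \<in> N \<Longrightarrow> f (u m) = (fst (f m), snd (f (inv \<sigma> m)))"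
    using row_sorting_permutation [OF N f permutes_inv [OF \<sigma>]] by blast
  have "preserves N (fst \<circ> f) (inv u)"
    using u by (simp add: preserves_inv [OF up]) (simp add: preserves_def)
  moreover have "preserves N (snd \<circ> f) (u \<circ> \<sigma>)"
    using u permutes_in_image [OF \<sigma>] by (simp add: preserves_def permutes_inverses [OF \<sigma>])
  ultimately show thesis
    using up \<sigma> by (intro that(1) [of "inv u" "u \<circ> \<sigma>"])
      (simp_all add: permutes_inv permutes_compose permutes_comp_cancel)
qed

lemma young_covariant_unique:
  assumes "finite N" "bij_betw f N (I \<times> J)" "\<sigma> permutes N"
    and y: "young_covariant N f y" and c: "young_covariant N f c" "c id = 1"
  shows "y \<sigma> = y id * c \<sigma>"
proof (cases rule: rectangle_dichotomy [OF assms(1-3), case_names factors transposition])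
  case (factors u v)
  have determined: "z \<sigma> = of_int (sign v) * z id" if "young_covariant N f z" for z
    using young_covariant_row [OF that factors(1,2,3)]
      young_covariant_column [OF that factors(3,4) permutes_id] factors(5) by simp
  show ?thesis
    using determined [OF y] determined [OF c(1)] c(2) by simp
next
  case (transposition t v)
  have vanishes: "z \<sigma> = 0" if "young_covariant N f z" for z
    using young_covariant_row [OF that transposition(1,2) assms(3)]
      young_covariant_column [OF that transposition(3,4) assms(3)] transposition(5,6) by simp
  show ?thesis
    using vanishes [OF y] vanishes [OF c(1)] by simp
qed

lemma young_coeff_convolution_self:
  assumes "finite N" "bij_betw f N (I \<times> J)" "\<sigma> permutes N"
  shows "convolution N (young_coeff N f) (young_coeff N f) \<sigma> =
    convolution N (young_coeff N f) (young_coeff N f) id * young_coeff N f \<sigma>"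
proof (rule young_covariant_unique [OF assms])
  have covariant: "young_covariant N f (young_coeff N f)"
    by (rule young_covariant_young_coeff [OF assms(1)])
  then show "young_covariant N f (young_coeff N f)" .
  show "young_covariant N f (convolution N (young_coeff N f) (young_coeff N f))"
    using young_covariant_row [OF covariant] young_covariant_column [OF covariant]
    by (intro young_covariant_convolution) auto
  show "young_coeff N f id = 1"
    using assms(2) by (intro young_coeff_id assms(1)) (simp add: bij_betw_def)
qed


section \<open>Traces on left ideals of the group algebra\<close>

lemma mem_Sym_iff: "w \<in> Sym n \<longleftrightarrow> w permutes {..<n}"
  by (simp add: Sym_def)

lemma finite_Sym: "finite (Sym n)"
  by (simp add: Sym_def finite_permutations)

lemma card_Sym: "card (Sym n) = fact n"
  unfolding Sym_def by (rule card_permutations) auto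

lemma gmult_apply:
  assumes "w \<in> Sym n"
  shows "gmult n x y w = convolution {..<n} x y w"
  unfolding gmult_def convolution_def Sym_def [symmetric]
proof (rule sum.cong [OF refl])
  fix u assume u: "u \<in> Sym n"
  then have up: "u permutes {..<n}" by (simp add: mem_Sym_iff)
  have "u \<circ> v = w \<longleftrightarrow> v = inv u \<circ> w" for v
    by (metis permutes_comp_cancel [OF up])
  then have "(\<Sum>v\<in>Sym n. if u \<circ> v = w then x u * y v else 0) =
      (\<Sum>v\<in>Sym n. if v = inv u \<circ> w then x u * y v else 0)" by simp
  also have "inv u \<circ> w \<in> Sym n"
    using assms up by (simp add: mem_Sym_iff permutes_compose permutes_inv)
  then have "(\<Sum>v\<in>Sym n. if v = inv u \<circ> w then x u * y v else 0) = x u * y (inv u \<circ> w)"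
    by (simp add: sum.delta finite_Sym)
  finally show "(\<Sum>v\<in>Sym n. if u \<circ> v = w then x u * y v else 0) = x u * y (inv u \<circ> w)" .
qed

lemma gmult_outside: "w \<notin> Sym n \<Longrightarrow> gmult n x y w = 0"
  unfolding gmult_def mem_Sym_iff
  by (intro sum.neutral ballI) (auto simp: mem_Sym_iff permutes_compose)

lemma gmult_in_group_algebra: "gmult n x y \<in> group_algebra n"
  by (simp add: group_algebra_def gmult_outside)

lemma gmult_cong: "(\<And>u. u \<in> Sym n \<Longrightarrow> x u = x' u) \<Longrightarrow> gmult n x y = gmult n x' y"
  unfolding gmult_def by (intro ext sum.cong refl) simp

lemma gmult_assoc: "gmult n (gmult n x y) z = gmult n x (gmult n y z)"
proof
  fix w
  show "gmult n (gmult n x y) z w = gmult n x (gmult n y z) w"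
  proof (cases "w \<in> Sym n")
    case True
    then have w: "w permutes {..<n}" by (simp add: mem_Sym_iff)
    have "gmult n (gmult n x y) z w = convolution {..<n} (convolution {..<n} x y) z w"
      unfolding gmult_apply [OF True]
      by (rule convolution_cong [OF w]) (simp_all add: gmult_apply mem_Sym_iff)
    also have "\<dots> = convolution {..<n} x (convolution {..<n} y z) w"
      by (rule convolution_assoc [OF w])
    also have "\<dots> = gmult n x (gmult n y z) w"
      unfolding gmult_apply [OF True]
      by (rule convolution_cong [OF w]) (simp_all add: gmult_apply mem_Sym_iff)
    finally show ?thesis .
  qed (simp add: gmult_outside)
qed

lemma linear_gmult_right: "Vector_Spaces.linear gscale gscale (\<lambda>x. gmult n x y)"
  and linear_gmult_left: "Vector_Spaces.linear gscale gscale (gmult n x)"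
  unfolding Vector_Spaces.linear_iff
  by (auto simp: galg.vector_space_axioms gmult_def gscale_def fun_eq_iff sum_distrib_left
      sum.distrib [symmetric] algebra_simps intro!: sum.cong)

lemma gmult_gelem:
  assumes "g \<in> Sym n" "w \<in> Sym n"
  shows "gmult n (gelem g) x w = x (inv g \<circ> w)"
proof -
  have "gmult n (gelem g) x w = (\<Sum>u\<in>Sym n. if u = g then x (inv u \<circ> w) else 0)"
    unfolding gmult_apply [OF assms(2)] gelem_def convolution_def Sym_def
    by (intro sum.cong refl) auto
  then show ?thesis using assms(1) by (simp add: sum.delta finite_Sym)
qed

lemma sum_galg_apply: "(\<Sum>i\<in>A. f i) x = (\<Sum>i\<in>A. f i x)" for f :: "_ \<Rightarrow> galg"
  by (induction A rule: infinite_finite_induct) auto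

lemma sum_gscale_gelem_apply:
  assumes "finite A"
  shows "(\<Sum>u\<in>A. gscale (f u) (gelem u)) w = (if w \<in> A then f w else 0)"
  using assms unfolding sum_galg_apply
  by (simp add: gscale_def gelem_def if_distrib sum.delta' cong: if_cong)

lemma group_algebra_expand:
  assumes "x \<in> group_algebra n"
  shows "x = (\<Sum>g\<in>Sym n. gscale (x g) (gelem g))"
  using assms by (intro ext) (simp add: sum_gscale_gelem_apply finite_Sym group_algebra_def)

lemma trace_on_basis:
  assumes V: "galg.subspace V" "V \<subseteq> group_algebra n"
  obtains B where "galg.independent B" "galg.span B = V" "finite B" "card B = galg.dim V"
    "\<And>T. trace_on V T = (\<Sum>b\<in>B. galg.representation B (T b) b)"
proof -
  define B where "B = (SOME B. galg.independent B \<and> galg.span B = V)"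
  obtain B' where "B' \<subseteq> V" "galg.independent B'" "V \<subseteq> galg.span B'"
    by (rule galg.maximal_independent_subset)
  then have "galg.independent B' \<and> galg.span B' = V"
    using galg.span_subspace [OF _ _ V(1)] by blast
  then have B: "galg.independent B" "galg.span B = V"
    unfolding B_def by (metis (mono_tags, lifting) someI_ex)+
  have "group_algebra n \<subseteq> galg.span (gelem ` Sym n)"
  proof
    fix x assume "x \<in> group_algebra n"
    then have "x = (\<Sum>g\<in>Sym n. gscale (x g) (gelem g))" by (rule group_algebra_expand)
    moreover have "\<dots> \<in> galg.span (gelem ` Sym n)"
      by (intro galg.span_sum galg.span_scale galg.span_base) auto
    ultimately show "x \<in> galg.span (gelem ` Sym n)" by simp
  qed
  then have "B \<subseteq> galg.span (gelem ` Sym n)"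
    using B(2) V(2) galg.span_superset by blast
  then have "finite B"
    using galg.independent_span_bound [OF finite_imageI [OF finite_Sym] B(1)] by blast
  moreover have "card B = galg.dim V"
    using galg.dim_eq_card [of B V] B galg.span_eq_iff V(1) by metis
  moreover have "trace_on V T = (\<Sum>b\<in>B. galg.representation B (T b) b)" for T
    by (simp add: trace_on_def B_def Let_def)
  ultimately show thesis using that B by blast
qed

lemma trace_on_scale:
  assumes V: "galg.subspace V" "V \<subseteq> group_algebra n"
    and T: "\<And>b. b \<in> V \<Longrightarrow> T b \<in> V" and S: "\<And>b. b \<in> V \<Longrightarrow> S b = gscale a (T b)"
  shows "trace_on V S = a * trace_on V T"
proof -
  obtain B where B: "galg.independent B" "galg.span B = V" "finite B" "card B = galg.dim V"
    and trace: "\<And>T. trace_on V T = (\<Sum>b\<in>B. galg.representation B (T b) b)"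
    by (rule trace_on_basis [OF V]) blast
  have "galg.representation B (S b) b = a * galg.representation B (T b) b" if "b \<in> B" for b
  proof -
    have "b \<in> V" using that B(2) galg.span_superset by blast
    with T B(2) show ?thesis
      by (simp add: S galg.representation_scale [OF B(1)])
  qed
  then show ?thesis
    unfolding trace by (simp add: sum_distrib_left)
qed

lemma trace_on_ident:
  assumes "galg.subspace V" "V \<subseteq> group_algebra n"
  shows "trace_on V (\<lambda>x. x) = of_nat (galg.dim V)"
proof -
  obtain B where B: "galg.independent B" "galg.span B = V" "finite B" "card B = galg.dim V"
    and trace: "\<And>T. trace_on V T = (\<Sum>b\<in>B. galg.representation B (T b) b)"
    by (rule trace_on_basis [OF assms]) blast
  then show ?thesis
    by (simp add: galg.representation_basis)
qed

text \<open>The right-hand side is the trace of \<open>T\<close> on the whole group algebra.\<close>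

lemma trace_on_eq_sum_diagonal:
  assumes V: "galg.subspace V" "V \<subseteq> group_algebra n"
    and linear: "Vector_Spaces.linear gscale gscale T" and T: "\<And>x. T x \<in> V"
  shows "trace_on V T = (\<Sum>g\<in>Sym n. T (gelem g) g)"
proof -
  obtain B where B: "galg.independent B" "galg.span B = V" "finite B" "card B = galg.dim V"
    and trace: "\<And>T. trace_on V T = (\<Sum>b\<in>B. galg.representation B (T b) b)"
    by (rule trace_on_basis [OF V]) blast
  interpret T: Vector_Spaces.linear gscale gscale T by (rule linear)
  let ?rep = "galg.representation B"
  have T_span: "T x \<in> galg.span B" for x using T B(2) by simp
  then have T_expand: "T x = (\<Sum>b\<in>B. gscale (?rep (T x) b) b)" for x
    by (rule galg.sum_representation_eq [OF B(1) _ B(3) subset_refl, symmetric])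
  have "?rep (T b) b = (\<Sum>g\<in>Sym n. b g * ?rep (T (gelem g)) b)" if "b \<in> B" for b
  proof -
    have "b \<in> group_algebra n" using that B(2) V(2) galg.span_superset by blast
    then have "T b = T (\<Sum>g\<in>Sym n. gscale (b g) (gelem g))"
      by (intro arg_cong [of _ _ T] group_algebra_expand)
    also have "\<dots> = (\<Sum>g\<in>Sym n. gscale (b g) (T (gelem g)))"
      by (simp only: T.sum T.scale)
    finally have "?rep (T b) b = (\<Sum>g\<in>Sym n. ?rep (gscale (b g) (T (gelem g))) b)"
      by (simp add: galg.representation_sum [OF B(1) galg.span_scale [OF T_span]])
    then show ?thesis
      by (simp add: galg.representation_scale [OF B(1) T_span])
  qed
  then have "trace_on V T = (\<Sum>g\<in>Sym n. \<Sum>b\<in>B. b g * ?rep (T (gelem g)) b)"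
    unfolding trace by (simp add: sum.swap [of _ B])
  also have "\<dots> = (\<Sum>g\<in>Sym n. (\<Sum>b\<in>B. gscale (?rep (T (gelem g)) b) b) g)"
    unfolding sum_galg_apply gscale_def by (simp add: mult.commute)
  also have "\<dots> = (\<Sum>g\<in>Sym n. T (gelem g) g)"
    unfolding T_expand [symmetric] ..
  finally show ?thesis .
qed

definition left_ideal :: "nat \<Rightarrow> galg \<Rightarrow> galg set"
  where "left_ideal n c = (\<lambda>x. gmult n x c) ` group_algebra n"

lemma gmult_in_left_ideal: "gmult n x c \<in> left_ideal n c"
proof -
  let ?x = "\<lambda>u. if u \<in> Sym n then x u else 0"
  have "gmult n x c = gmult n ?x c" by (rule gmult_cong) simp
  moreover have "?x \<in> group_algebra n" by (simp add: group_algebra_def)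
  ultimately show ?thesis unfolding left_ideal_def by blast
qed

lemma gmult_left_ideal: "b \<in> left_ideal n c \<Longrightarrow> gmult n x b \<in> left_ideal n c"
  using gmult_in_left_ideal by (auto simp: left_ideal_def gmult_assoc [symmetric])

lemma left_ideal_subset_group_algebra: "left_ideal n c \<subseteq> group_algebra n"
  using gmult_in_group_algebra by (auto simp: left_ideal_def)

lemma subspace_left_ideal: "galg.subspace (left_ideal n c)"
proof -
  interpret R: Vector_Spaces.linear gscale gscale "\<lambda>x. gmult n x c" by (rule linear_gmult_right)
  have "galg.subspace (range (\<lambda>x. gmult n x c))"
    by (intro R.subspace_image galg.subspace_UNIV)
  also have "range (\<lambda>x. gmult n x c) = left_ideal n c"
    using gmult_in_left_ideal by (auto simp: left_ideal_def)
  finally show ?thesis .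
qed

text \<open>Right multiplication by \<open>c\<close> maps the group algebra into the left ideal of \<open>c\<close>, on which it
  is the scalar \<open>\<gamma>\<close>; comparing traces gives the dimension and the character of the ideal.\<close>

lemma left_ideal_character:
  assumes cc: "gmult n c c = gscale \<gamma> c" and "c id = 1" and w: "w \<in> Sym n"
  shows "trace_on (left_ideal n c) (gmult n (gelem w)) / of_nat (galg.dim (left_ideal n c)) =
    (\<Sum>g\<in>Sym n. c (g \<circ> inv w \<circ> inv g)) / fact n"
proof -
  let ?V = "left_ideal n c"
  note V = subspace_left_ideal [of n c] left_ideal_subset_group_algebra [of n c]
  have scalar: "gmult n b c = gscale \<gamma> b" if "b \<in> ?V" for b
    using that linear_gmult_left [of n]
    by (auto simp: left_ideal_def gmult_assoc cc Vector_Spaces.linear_iff)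
  have linear: "Vector_Spaces.linear gscale gscale (\<lambda>x. gmult n (gmult n y x) c)" for y
    using Vector_Spaces.linear_compose [OF linear_gmult_left linear_gmult_right]
    by (simp only: comp_def)
  have "\<gamma> * of_nat (galg.dim ?V) = trace_on ?V (\<lambda>x. gmult n x c)"
    using trace_on_scale [OF V _ scalar, of "\<lambda>x. x"] by (simp add: trace_on_ident [OF V])
  also have "\<dots> = (\<Sum>g\<in>Sym n. gmult n (gelem g) c g)"
    by (intro trace_on_eq_sum_diagonal V linear_gmult_right gmult_in_left_ideal)
  also have "\<dots> = fact n"
    by (simp add: gmult_gelem mem_Sym_iff permutes_inv_o \<open>c id = 1\<close>)
      (simp flip: Sym_def add: card_Sym)
  finally have dim: "\<gamma> * of_nat (galg.dim ?V) = fact n" .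
  have "\<gamma> * trace_on ?V (gmult n (gelem w)) = trace_on ?V (\<lambda>x. gmult n (gmult n (gelem w) x) c)"
    by (rule trace_on_scale [OF V, symmetric]) (auto intro: gmult_left_ideal scalar)
  also have "\<dots> = (\<Sum>g\<in>Sym n. gmult n (gmult n (gelem w) (gelem g)) c g)"
    by (intro trace_on_eq_sum_diagonal V linear gmult_in_left_ideal)
  also have "\<dots> = (\<Sum>g\<in>Sym n. c (inv g \<circ> (inv w \<circ> g)))"
    using w by (intro sum.cong refl)
      (simp add: gmult_assoc gmult_gelem mem_Sym_iff permutes_compose permutes_inv)
  also have "\<dots> = (\<Sum>g\<in>Sym n. c (g \<circ> inv w \<circ> inv g))"
    unfolding Sym_def
    by (subst sum_permutations_inverse) (intro sum.cong refl, simp add: permutes_inv_inv comp_assoc)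
  finally have trace: "\<gamma> * trace_on ?V (gmult n (gelem w)) = (\<Sum>g\<in>Sym n. c (g \<circ> inv w \<circ> inv g))" .
  have "\<gamma> \<noteq> 0" using dim by auto
  then show ?thesis
    by (simp flip: dim trace)
qed


section \<open>Characters of rectangular shape\<close>

lemma young_symmetrizer_apply:
  assumes "\<tau> \<in> Sym (sum_mset \<nu>)"
  shows "young_symmetrizer \<nu> \<tau> = young_coeff {..<sum_mset \<nu>} ((!) (boxes \<nu>)) \<tau>"
proof -
  let ?N = "{..<sum_mset \<nu>}" and ?f = "(!) (boxes \<nu>)"
  have rows: "row_group \<nu> = {u \<in> Sym (sum_mset \<nu>). preserves ?N (fst \<circ> ?f) u}"
    and columns: "column_group \<nu> = {v \<in> Sym (sum_mset \<nu>). preserves ?N (snd \<circ> ?f) v}"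
    by (auto simp: row_group_def column_group_def preserves_def)
  then have fin: "finite (row_group \<nu>)" "finite (column_group \<nu>)"
    by (simp_all add: finite_Sym)
  have "(\<Sum>u\<in>row_group \<nu>. gelem u) \<sigma> = row_indicator ?N ?f \<sigma>"
    "(\<Sum>v\<in>column_group \<nu>. gscale (of_int (sign v)) (gelem v)) \<sigma> = column_sign ?N ?f \<sigma>"
    if "\<sigma> permutes ?N" for \<sigma>
    using that sum_gscale_gelem_apply [OF fin(1), of "\<lambda>_. 1"] sum_gscale_gelem_apply [OF fin(2)]
    by (simp_all add: rows columns mem_Sym_iff row_indicator_def column_sign_def)
  then show ?thesis
    using assms unfolding young_symmetrizer_def gmult_apply [OF assms] young_coeff_def
    by (intro convolution_cong) (simp_all add: mem_Sym_iff)
qed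

lemma sum_mset_rect: "sum_mset (rect p q) = p * q"
  by (simp add: rect_def)

lemma parts_rect: "parts (rect p q) = replicate p q"
proof -
  have "sort (replicate p q) = replicate p q"
    by (simp add: sorted_sort_id)
  then have "sorted_list_of_multiset (replicate_mset p q) = replicate p q"
    by (metis mset_replicate sorted_list_of_multiset_mset)
  then show ?thesis by (simp add: parts_def rect_def)
qed

lemma boxes_rect: "boxes (rect p q) = List.product [0..<p] [0..<q]"
  unfolding boxes_def parts_rect product_concat_map
  by (auto simp: rect_def intro!: arg_cong [of _ _ concat])

lemma bij_betw_boxes_rect: "bij_betw ((!) (boxes (rect p q))) {..<p * q} ({..<p} \<times> {..<q})"
  by (rule bij_betw_nth) (auto simp: boxes_rect distinct_product)

lemma young_symmetrizer_rect:
  "\<tau> permutes {..<p * q} \<Longrightarrow>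
    young_symmetrizer (rect p q) \<tau> = young_coeff {..<p * q} ((!) (boxes (rect p q))) \<tau>"
  using young_symmetrizer_apply [of \<tau> "rect p q"] by (simp add: sum_mset_rect mem_Sym_iff)

lemma young_symmetrizer_rect_square:
  obtains \<gamma> where "gmult (p * q) (young_symmetrizer (rect p q)) (young_symmetrizer (rect p q)) =
    gscale \<gamma> (young_symmetrizer (rect p q))"
proof
  let ?c = "young_symmetrizer (rect p q)" and ?y = "young_coeff {..<p * q} ((!) (boxes (rect p q)))"
  show "gmult (p * q) ?c ?c = gscale (convolution {..<p * q} ?y ?y id) ?c"
  proof
    fix \<sigma>
    show "gmult (p * q) ?c ?c \<sigma> = gscale (convolution {..<p * q} ?y ?y id) ?c \<sigma>"
    proof (cases "\<sigma> \<in> Sym (p * q)")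
      case True
      then have \<sigma>: "\<sigma> permutes {..<p * q}" by (simp add: mem_Sym_iff)
      have "gmult (p * q) ?c ?c \<sigma> = convolution {..<p * q} ?y ?y \<sigma>"
        unfolding gmult_apply [OF True] by (intro convolution_cong \<sigma> young_symmetrizer_rect)
      also have "\<dots> = convolution {..<p * q} ?y ?y id * ?y \<sigma>"
        by (rule young_coeff_convolution_self [OF _ bij_betw_boxes_rect \<sigma>]) simp
      finally show ?thesis by (simp add: gscale_def young_symmetrizer_rect [OF \<sigma>])
    next
      case False
      then have "?c \<sigma> = 0"
        unfolding young_symmetrizer_def sum_mset_rect by (rule gmult_outside)
      with False show ?thesis by (simp add: gmult_outside gscale_def)
    qed
  qed
qed

lemma normalized_irr_character_rect:
  assumes w: "w permutes K" and K: "K \<subseteq> {..<p * q}"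
  shows "irr_character (rect p q) w / of_nat (irr_dim (rect p q)) =
    fact (p * q - card K) * factorization_sum {..<p} {..<q} K (inv w) / fact (p * q)"
proof -
  let ?c = "young_symmetrizer (rect p q)" and ?y = "young_coeff {..<p * q} ((!) (boxes (rect p q)))"
  have "?c id = 1"
    using bij_betw_boxes_rect [of p q]
    by (simp add: young_symmetrizer_rect young_coeff_id bij_betw_def)
  moreover have w_Sym: "w \<in> Sym (p * q)"
    using permutes_subset [OF w K] by (simp add: mem_Sym_iff)
  moreover obtain \<gamma> where "gmult (p * q) ?c ?c = gscale \<gamma> ?c"
    by (rule young_symmetrizer_rect_square)
  ultimately have "trace_on (left_ideal (p * q) ?c) (gmult (p * q) (gelem w)) /
      of_nat (galg.dim (left_ideal (p * q) ?c)) =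
      (\<Sum>g\<in>Sym (p * q). ?c (g \<circ> inv w \<circ> inv g)) / fact (p * q)"
    by (intro left_ideal_character)
  also have "(\<Sum>g\<in>Sym (p * q). ?c (g \<circ> inv w \<circ> inv g)) =
      (\<Sum>g | g permutes {..<p * q}. ?y (g \<circ> inv w \<circ> inv g))"
    unfolding Sym_def using w_Sym
    by (intro sum.cong refl young_symmetrizer_rect permutes_compose permutes_inv)
      (simp_all add: mem_Sym_iff)
  also have "\<dots> = fact (p * q - card K) * factorization_sum {..<p} {..<q} K (inv w)"
    using sum_young_coeff_conj [OF _ bij_betw_boxes_rect _ _ K permutes_inv [OF w]] by simp
  finally show ?thesis
    by (simp add: irr_character_def irr_dim_def specht_def left_ideal_def sum_mset_rect)
qed

lemma factorization_sum_eq_0: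
  assumes "finite K" "finite C" "finite D" "w permutes K" "card C * card D < card K"
  shows "factorization_sum C D K w = 0"
proof -
  have "\<not> inj_on f K" if "f \<in> K \<rightarrow>\<^sub>E C \<times> D" for f
  proof
    assume "inj_on f K"
    moreover have "f ` K \<subseteq> C \<times> D" using that by (simp add: PiE_iff image_subset_iff)
    ultimately have "card K \<le> card (C \<times> D)"
      using assms(2,3) by (intro card_inj_on_le [of f]) auto
    then show False using assms(5) by (simp add: card_cartesian_product)
  qed
  then have "(\<Sum>f\<in>K \<rightarrow>\<^sub>E C \<times> D. young_coeff K f w) = 0"
    by (intro sum.neutral ballI young_coeff_not_inj assms(1,4))
  then show ?thesis
    by (simp only: sum_young_coeff [OF assms(1-4)])
qed


section \<open>Cycles and their cycle type\<close>

lemma cyclic_on_inv: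
  assumes "finite K" "w permutes K" "cyclic_on w K"
  shows "cyclic_on (inv w) K"
  using assms(3) orbit_inv_eq [OF permutes_imp_permutation [OF assms(1,2)]]
  by (simp add: cyclic_on_def)

lemma cyclic_on_of_cycle_type:
  assumes w: "w permutes {..<n}" and type: "cycle_type n w = {#k#} + replicate_mset (n - k) 1"
  obtains K where "K \<subseteq> {..<n}" "card K = k" "w permutes K" "cyclic_on w K"
proof -
  have perm: "permutation w" using w by (auto intro: permutes_imp_permutation)
  let ?orbits = "orbit w ` {..<n}"
  have "k \<in># image_mset card (mset_set ?orbits)" using type by (simp add: cycle_type_def)
  then obtain K where K: "K \<in> ?orbits" "card K = k" by auto
  then have "mset_set ?orbits = add_mset K (mset_set (?orbits - {K}))"
    by (simp add: mset_set.remove)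
  then have rest: "image_mset card (mset_set (?orbits - {K})) = replicate_mset (n - k) 1"
    using type K by (simp add: cycle_type_def)
  obtain x where x: "x < n" "K = orbit w x" using K by auto
  have "w y = y" if y: "y \<in> {..<n} - K" for y
  proof -
    have "y \<in> orbit w y" using perm by (rule permutation_self_in_orbit)
    then have "orbit w y \<in> ?orbits - {K}" using y by auto
    then have "card (orbit w y) \<in># image_mset card (mset_set (?orbits - {K}))" by auto
    then have "card (orbit w y) = 1"
      unfolding rest by (auto simp: in_replicate_mset split: if_splits)
    then obtain z where "orbit w y = {z}" by (rule card_1_singletonE)
    with \<open>y \<in> orbit w y\<close> orbit.base [of w y] show ?thesis by auto
  qed
  with w have "w permutes K" by (rule permutes_superset)
  moreover have "K \<subseteq> {..<n}" unfolding x(2) using w x(1) by (intro permutes_orbit_subset) auto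
  moreover have "cyclic_on w K" unfolding x(2) by (rule cyclic_on_orbit' [OF perm])
  ultimately show thesis using that K(2) by blast
qed

lemma cycle_type_of_cyclic_on:
  assumes w: "w permutes K" "cyclic_on w K" and K: "K \<subseteq> {..<n}"
  shows "cycle_type n w = {#card K#} + replicate_mset (n - card K) 1"
proof -
  have "finite K" using K finite_subset by auto
  have orbit: "orbit w x = (if x \<in> K then K else {x})" for x
    using orbit_cyclic_eq3 [OF w(2)] permutes_not_in [OF w(1)] by (simp add: orbit_eq_singleton_iff)
  have "K \<noteq> {}" using w(2) by (auto simp: cyclic_on_def)
  then have "orbit w ` {..<n} = insert K ((\<lambda>x. {x}) ` ({..<n} - K))"
    using K unfolding orbit [abs_def] by (auto simp: image_iff)
  moreover have "K \<notin> (\<lambda>x. {x}) ` ({..<n} - K)" by auto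
  moreover have "image_mset card (mset_set ((\<lambda>x. {x}) ` ({..<n} - K))) =
      replicate_mset (n - card K) 1"
  proof -
    have "mset_set ((\<lambda>x. {x}) ` ({..<n} - K)) = image_mset (\<lambda>x. {x}) (mset_set ({..<n} - K))"
      by (rule image_mset_mset_set [symmetric]) simp
    then show ?thesis
      using K \<open>finite K\<close>
      by (simp add: image_mset.compositionality comp_def image_mset_const_eq card_Diff_subset)
  qed
  ultimately show ?thesis
    unfolding cycle_type_def by simp
qed

lemma cyclic_permutation_exists:
  fixes k :: nat
  assumes "0 < k"
  obtains w where "w permutes {..<k}" "cyclic_on w {..<k}"
proof -
  define w where "w x = (if x < k then if Suc x = k then 0 else Suc x else x)" for x
  have w: "w permutes {..<k}"
  proof (rule inj_imp_permutes)
    show "inj_on w {..<k}"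
      by (rule inj_onI) (auto simp: w_def split: if_splits)
  qed (use assms in \<open>auto simp: w_def\<close>)
  then have perm: "permutation w" by (auto intro: permutes_imp_permutation)
  have "x \<in> orbit w 0" if "x < k" for x
    using that
  proof (induction x)
    case 0
    show ?case using perm by (rule permutation_self_in_orbit)
  next
    case (Suc x)
    then have "w x = Suc x" by (simp add: w_def)
    with Suc show ?case using orbit.step [of x w 0] by simp
  qed
  moreover have "orbit w 0 \<subseteq> {..<k}" using w assms by (intro permutes_orbit_subset) auto
  ultimately have "cyclic_on w {..<k}"
    using assms by (intro cyclic_on_singleI [of 0]) auto
  with w that show thesis by blast
qed


section \<open>The character of a cycle on a rectangle\<close>

definition cycle_hook_formula :: "nat \<Rightarrow> complex \<Rightarrow> complex \<Rightarrow> complex"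
  where "cycle_hook_formula n p q =
    (\<Sum>m\<le>n. of_nat (n choose m) * ((-1) ^ m *
      (falling (p + of_nat (n - m)) (Suc n) * falling (q + of_nat m) (Suc n)))) / fact (Suc n)"

lemma factorization_sum_cyclic_eq_hook_formula:
  assumes "card K = Suc n" "w permutes K" "cyclic_on w K"
  shows "factorization_sum C D K w = cycle_hook_formula n (of_nat (card C)) (of_nat (card D))"
  unfolding cycle_hook_formula_def factorization_sum_cyclic [OF assms, symmetric]
  by (simp del: fact_Suc)

lemma normalized_irr_character_at_cycle_rect:
  assumes "Suc n \<le> p * q"
  shows "irr_character_at (rect p q) ({#Suc n#} + replicate_mset (p * q - Suc n) 1) /
      of_nat (irr_dim (rect p q)) =
    fact (p * q - Suc n) * cycle_hook_formula n (of_nat p) (of_nat q) / fact (p * q)"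
proof -
  let ?type = "{#Suc n#} + replicate_mset (p * q - Suc n) 1"
  obtain c where c: "c permutes {..<Suc n}" "cyclic_on c {..<Suc n}"
    by (rule cyclic_permutation_exists [OF zero_less_Suc])
  have subset: "{..<Suc n} \<subseteq> {..<p * q}" using assms by (simp only: lessThan_subset_iff)
  have "cycle_type (p * q) c = ?type"
    using cycle_type_of_cyclic_on [OF c subset] by (simp only: card_lessThan)
  then have "\<exists>w. w \<in> Sym (p * q) \<and> cycle_type (p * q) w = ?type"
    using permutes_subset [OF c(1) subset] mem_Sym_iff by blast
  moreover define w where "w = (SOME w. w \<in> Sym (p * q) \<and> cycle_type (p * q) w = ?type)"
  ultimately have w: "w \<in> Sym (p * q) \<and> cycle_type (p * q) w = ?type"
    by (metis (mono_tags, lifting) someI_ex)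
  then have "w permutes {..<p * q}" by (simp only: mem_Sym_iff)
  then obtain K where K: "K \<subseteq> {..<p * q}" "card K = Suc n" "w permutes K" "cyclic_on w K"
    using cyclic_on_of_cycle_type w by blast
  then have "finite K" using finite_subset by blast
  have "factorization_sum {..<p} {..<q} K (inv w) = cycle_hook_formula n (of_nat p) (of_nat q)"
    using factorization_sum_cyclic_eq_hook_formula
      [OF K(2) permutes_inv [OF K(3)] cyclic_on_inv [OF \<open>finite K\<close> K(3,4)], of "{..<p}" "{..<q}"]
    by (simp only: card_lessThan)
  then show ?thesis
    using normalized_irr_character_rect [OF K(3,1)]
    by (simp add: K(2) irr_character_at_def sum_mset_rect w_def)
qed

lemma Ch_rect_nat: "Ch {#Suc n#} (rect p q) = cycle_hook_formula n (of_nat p) (of_nat q)"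
proof (cases "Suc n \<le> p * q")
  case True
  then have "Ch {#Suc n#} (rect p q) = falling (of_nat (p * q)) (Suc n) *
      (irr_character_at (rect p q) ({#Suc n#} + replicate_mset (p * q - Suc n) 1) /
        of_nat (irr_dim (rect p q)))"
    by (simp add: Ch_def Let_def sum_mset_rect)
  also have "\<dots> = falling (of_nat (p * q)) (Suc n) * fact (p * q - Suc n) *
      cycle_hook_formula n (of_nat p) (of_nat q) / fact (p * q)"
    unfolding normalized_irr_character_at_cycle_rect [OF True] by simp
  also have "\<dots> = cycle_hook_formula n (of_nat p) (of_nat q)"
    unfolding falling_of_nat_mult_fact [OF True] by simp
  finally show ?thesis .
next
  case False
  obtain c where c: "c permutes {..<Suc n}" "cyclic_on c {..<Suc n}"
    by (rule cyclic_permutation_exists [OF zero_less_Suc])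
  have "factorization_sum {..<p} {..<q} {..<Suc n} c = 0"
    using False c(1)
    by (intro factorization_sum_eq_0) (simp_all only: card_lessThan finite_lessThan not_le)
  then have "cycle_hook_formula n (of_nat p) (of_nat q) = 0"
    using factorization_sum_cyclic_eq_hook_formula [OF _ c, of n "{..<p}" "{..<q}"]
    by (simp only: card_lessThan)
  with False show ?thesis by (simp add: Ch_def sum_mset_rect)
qed


section \<open>The interpolating polynomial\<close>

definition is_ring_hom :: "('a::comm_ring_1 \<Rightarrow> 'b::comm_ring_1) \<Rightarrow> bool"
  where "is_ring_hom h \<longleftrightarrow> h 1 = 1 \<and> (\<forall>a b. h (a + b) = h a + h b) \<and> (\<forall>a b. h (a * b) = h a * h b)"

lemma is_ring_homD:
  assumes "is_ring_hom h"
  shows "h 1 = 1" "h (a + b) = h a + h b" "h (a * b) = h a * h b"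
    "h 0 = 0" "h (a - b) = h a - h b" "h (of_nat n) = of_nat n"
proof -
  show one: "h 1 = 1" and add: "h (a + b) = h a + h b" and "h (a * b) = h a * h b" for a b
    using assms by (simp_all add: is_ring_hom_def)
  show zero: "h 0 = 0" using add [of 0 0] by simp
  show "h (a - b) = h a - h b" using add [of "a - b" b] by simp
  show "h (of_nat n) = of_nat n" by (induction n) (simp_all add: zero one add)
qed

lemma is_ring_hom_falling: "is_ring_hom h \<Longrightarrow> h (falling a k) = falling (h a) k"
  by (induction k) (simp_all add: falling_Suc is_ring_homD)

lemma is_ring_hom_sum: "is_ring_hom h \<Longrightarrow> h (\<Sum>i\<in>A. f i) = (\<Sum>i\<in>A. h (f i))"
  by (induction A rule: infinite_finite_induct) (simp_all add: is_ring_homD)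

lemma is_ring_hom_of_rat: "is_ring_hom (of_rat :: rat \<Rightarrow> 'a::field_char_0)"
  by (simp add: is_ring_hom_def of_rat_add of_rat_mult)

lemma is_ring_hom_poly_map_poly:
  assumes "is_ring_hom h"
  shows "is_ring_hom (\<lambda>P. poly (map_poly h P) x)"
proof -
  have add: "map_poly h (P + Q) = map_poly h P + map_poly h Q" for P Q
    by (intro poly_eqI) (simp add: coeff_map_poly is_ring_homD [OF assms])
  have "map_poly h (P * Q) = map_poly h P * map_poly h Q" for P Q
  proof (induction P)
    case (pCons a P)
    then show ?case
      by (simp add: map_poly_pCons add map_poly_smult is_ring_homD [OF assms])
  qed simp
  with add show ?thesis
    by (simp add: is_ring_hom_def is_ring_homD [OF assms] map_poly_1)
qed

lemma poly_eqI_of_nat: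
  fixes P Q :: "'a::{idom,ring_char_0} poly"
  assumes "\<And>n. 0 < n \<Longrightarrow> poly P (of_nat n) = poly Q (of_nat n)"
  shows "P = Q"
proof (rule poly_eqI_degree)
  let ?A = "of_nat ` {0<..degree P + degree Q + 1} :: 'a set"
  show "poly P x = poly Q x" if "x \<in> ?A" for x using assms that by auto
  show "degree P < card ?A" "degree Q < card ?A" by (simp_all add: card_image inj_on_def)
qed

lemma is_ring_hom_ratpoly: "is_ring_hom (\<lambda>c. poly (map_poly of_rat c) (q :: complex))"
  by (intro is_ring_hom_poly_map_poly is_ring_hom_of_rat)

lemma is_ring_hom_eval2: "is_ring_hom (\<lambda>P. eval2 P p q)"
  unfolding eval2_def by (intro is_ring_hom_poly_map_poly is_ring_hom_ratpoly)

lemma eval2_inject: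
  assumes "\<And>p q. 0 < p \<Longrightarrow> 0 < q \<Longrightarrow> eval2 P (of_nat p) (of_nat q) = eval2 Q (of_nat p) (of_nat q)"
  shows "P = Q"
proof (rule poly_eqI)
  fix i
  let ?eval = "\<lambda>q c. poly (map_poly of_rat c) q :: complex"
  have "map_poly (?eval (of_nat q)) P = map_poly (?eval (of_nat q)) Q" if "0 < q" for q
    using assms that by (intro poly_eqI_of_nat) (simp add: eval2_def)
  then have "?eval (of_nat q) (coeff P i) = ?eval (of_nat q) (coeff Q i)" if "0 < q" for q
    using that by (metis coeff_map_poly is_ring_homD(4) [OF is_ring_hom_ratpoly])
  then have "map_poly of_rat (coeff P i) = (map_poly of_rat (coeff Q i) :: complex poly)"
    by (rule poly_eqI_of_nat)
  then show "coeff P i = coeff Q i"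
    by (metis coeff_map_poly of_rat_0 of_rat_eq_iff poly_eqI)
qed

lemma Ch_rect_eqI:
  assumes "\<And>p q. 0 < p \<Longrightarrow> 0 < q \<Longrightarrow> eval2 P (of_nat p) (of_nat q) = Ch \<pi> (rect p q)"
  shows "Ch_rect \<pi> p q = eval2 P p q"
proof -
  have "Ch_rect_poly \<pi> = P"
    unfolding Ch_rect_poly_def using assms by (intro the_equality eval2_inject) auto
  then show ?thesis by (simp only: Ch_rect_def)
qed

lemma Ch_rect_cycle: "Ch_rect {#Suc n#} p q = cycle_hook_formula n p q"
proof -
  define X Y :: "rat poly poly" where "X = [:0, 1:]" and "Y = [:[:0, 1:]:]"
  define c :: "nat \<Rightarrow> rat poly poly"
    where "c m = [:[:of_nat (n choose m) * (-1) ^ m / fact (Suc n):]:]" for m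
  define P where "P = (\<Sum>m\<le>n. c m *
    (falling (X + of_nat (n - m)) (Suc n) * falling (Y + of_nat m) (Suc n)))"
  have "of_rat (fact (Suc n)) = (fact (Suc n) :: complex)"
    by (metis of_nat_fact of_rat_of_nat_eq)
  then have "eval2 (c m) p q = of_nat (n choose m) * (-1) ^ m / fact (Suc n)"
    "eval2 X p q = p" "eval2 Y p q = q" for m p q
    by (simp_all add: c_def X_def Y_def eval2_def map_poly_pCons of_rat_mult of_rat_divide
        of_rat_power del: fact_Suc)
  then have P: "eval2 P p q = cycle_hook_formula n p q" for p q
    unfolding P_def cycle_hook_formula_def sum_divide_distrib is_ring_hom_sum [OF is_ring_hom_eval2]
    by (simp add: is_ring_homD [OF is_ring_hom_eval2] is_ring_hom_falling [OF is_ring_hom_eval2]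
        mult.assoc del: of_nat_diff fact_Suc)
  have "Ch_rect {#Suc n#} p q = eval2 P p q"
    by (rule Ch_rect_eqI) (simp only: P Ch_rect_nat)
  then show ?thesis by (simp only: P)
qed


section \<open>The coefficients of the expansion\<close>

lemma cycle_hook_formula_eq_fdiff:
  "cycle_hook_formula n (e - d) (e + d) =
    (-1) ^ n * (fdiff ^^ n) (shifted_square_prod (Suc n) (e\<^sup>2)) d / fact (Suc n)"
proof -
  have summand: "(-1) ^ n * (of_nat (n choose m) *
        ((-1) ^ (n - m) * shifted_square_prod (Suc n) (e\<^sup>2) (d + of_nat m))) =
      of_nat (n choose m) * ((-1) ^ m *
        (falling (e - d + of_nat (n - m)) (Suc n) * falling (e + d + of_nat m) (Suc n)))"
    if "m \<le> n" for m
  proof -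
    have "shifted_square_prod (Suc n) (e\<^sup>2) (d + of_nat m) =
        falling (e + d + of_nat m) (Suc n) * falling (e - d + of_nat (n - m)) (Suc n)"
      using falling_mult_falling [of e "d + of_nat m" "Suc n"] that
      by (simp add: of_nat_diff algebra_simps)
    moreover have "(-1) ^ n * (-1) ^ (n - m) = ((-1) ^ m :: complex)"
      using that by (simp add: minus_one_power_iff)
    ultimately show ?thesis by (simp add: mult_ac)
  qed
  show ?thesis
    unfolding cycle_hook_formula_def fdiff_funpow_eq_sum sum_distrib_left
    by (intro arg_cong2 [of _ _ _ _ "(/)"] sum.cong refl summand [symmetric]) simp
qed

lemma dfact_odd_mult_fact: "dfact (2 * k + 1) * (2 ^ k * fact k) = fact (2 * k + 1)"
proof (induction k)
  case (Suc k)
  have "dfact (2 * Suc k + 1) * (2 ^ Suc k * fact (Suc k)) =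
      (2 * k + 3) * (2 * k + 2) * (dfact (2 * k + 1) * (2 ^ k * fact k))"
    by (simp add: algebra_simps)
  also have "\<dots> = fact (2 * Suc k + 1)"
    unfolding Suc by (simp add: algebra_simps)
  finally show ?case .
qed simp

lemma rising2_odd_mult_fact:
  "rising2 (2 * of_nat j + 1) k * (2 ^ k * fact (j + k) * fact (2 * j)) =
    (fact (2 * j + 2 * k) * fact j :: 'a::field_char_0)"
proof (induction k)
  case (Suc k)
  have "rising2 (2 * of_nat j + 1) (Suc k) * (2 ^ Suc k * fact (j + Suc k) * fact (2 * j)) =
    (rising2 (2 * of_nat j + 1) k * (2 ^ k * fact (j + k) * fact (2 * j))) *
      ((2 * of_nat j + 1 + 2 * of_nat k) * (2 * (of_nat j + of_nat k + 1)) :: 'a)"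
    by (simp add: rising2_def algebra_simps)
  also have "\<dots> = fact (2 * j + 2 * Suc k) * fact j"
    unfolding Suc by (simp add: algebra_simps)
  finally show ?case .
qed (simp add: rising2_def)

lemma gcoeff_eq_fact:
  assumes "k \<le> j"
  shows "gcoeff k j = (-1) ^ k * fact (2 * j + 2 * k) * (fact j)\<^sup>2 /
    (fact (j - k) * fact (j + k) * fact (2 * j) * fact (2 * k + 1))"
proof (cases "k = 0")
  case False
  have falling: "falling (of_nat j) k = (fact j / fact (j - k) :: complex)"
    using falling_of_nat_mult_fact [OF assms, where 'a = complex] by (simp add: field_simps)
  have rising: "rising2 (2 * of_nat j + 1 :: complex) k =
      fact (2 * j + 2 * k) * fact j / (2 ^ k * fact (j + k) * fact (2 * j))"
    using rising2_odd_mult_fact [of j k, where 'a = complex] by (simp add: field_simps)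
  have "of_nat (dfact (2 * k + 1) * (2 ^ k * fact k)) = (of_nat (fact (2 * k + 1)) :: complex)"
    by (simp only: dfact_odd_mult_fact)
  then have dfact: "of_nat (dfact (2 * k + 1)) = (fact (2 * k + 1) / (2 ^ k * fact k) :: complex)"
    by (simp add: field_simps del: dfact.simps fact_Suc)
  show ?thesis
    unfolding gcoeff_def falling rising dfact
    using False by (simp add: field_simps power2_eq_square del: fact_Suc)
qed (simp add: gcoeff_def power2_eq_square)

lemma twice_binomial_eq_fact:
  assumes "j \<ge> 1"
  shows "2 * of_nat ((2 * j - 1) choose j) = (fact (2 * j) / (fact j)\<^sup>2 :: 'a::field_char_0)"
proof -
  obtain i where j: "j = Suc i" using assms by (cases j) auto
  have "of_nat ((2 * j - 1) choose j) = (fact (2 * j - 1) / (fact j * fact i) :: 'a)"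
    using binomial_fact [of j "2 * j - 1", where 'a = 'a] j by simp
  moreover have "fact (2 * j) = (of_nat (2 * j) * fact (2 * j - 1) :: 'a)"
    by (rule fact_reduce) (use assms in simp)
  moreover have "(fact j)\<^sup>2 = (fact j * (of_nat j * fact i) :: 'a)"
    using j by (simp add: power2_eq_square)
  ultimately show ?thesis
    using assms by (simp add: field_simps)
qed

lemma binomial_mult_gcoeff_eq_fact:
  assumes "1 \<le> j" "k \<le> j"
  shows "(-1) ^ (j - 1) * of_nat ((2 * j - 1) choose j) * (2 * gcoeff k j) =
    - ((-1) ^ (j - k) * fact (2 * j + 2 * k) / (fact (j - k) * fact (j + k) * fact (2 * k + 1)))"
proof -
  have "(-1) ^ (j - 1) * of_nat ((2 * j - 1) choose j) * (2 * gcoeff k j) =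
      (-1) ^ (j - 1) * (2 * of_nat ((2 * j - 1) choose j)) * gcoeff k j"
    by simp
  also have "\<dots> = ((-1) ^ (j - 1) * (-1) ^ k) * fact (2 * j + 2 * k) /
      (fact (j - k) * fact (j + k) * fact (2 * k + 1))"
    unfolding twice_binomial_eq_fact [OF assms(1)] gcoeff_eq_fact [OF assms(2)]
    by (simp add: field_simps power2_eq_square del: fact_Suc)
  also have "(-1) ^ (j - 1) * (-1) ^ k = - ((-1) ^ (j - k) :: complex)"
    using assms by (cases "even j"; cases "even k") (auto simp: minus_one_power_iff)
  finally show ?thesis by simp
qed

theorem theorem1p7:
  fixes j :: nat and d e :: complex
  assumes "j \<ge> 1"
  shows "Ch_rect {#2 * j#} (e - d) (e + d) =
    (-1) ^ (j - 1) * of_nat ((2 * j - 1) choose j) *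
      (\<Sum>k = 0..j. gcoeff k j * (2 * d * (\<Prod>r = 1..k. d\<^sup>2 - (of_nat r)\<^sup>2)
                              * (\<Prod>r = k + 1..j. e\<^sup>2 - (of_nat r)\<^sup>2)))"
proof -
  let ?d = "\<lambda>k. d * (\<Prod>r = 1..k. d\<^sup>2 - (of_nat r)\<^sup>2)" and ?e = "\<lambda>k. \<Prod>r = k + 1..j. e\<^sup>2 - (of_nat r)\<^sup>2"
  have "Suc (2 * j - 1) = 2 * j" "odd (2 * j - 1)" using assms by auto
  then have "Ch_rect {#2 * j#} (e - d) (e + d) =
      - (fdiff ^^ (2 * j - 1)) (shifted_square_prod (2 * j) (e\<^sup>2)) d / fact (2 * j)"
    using Ch_rect_cycle [of "2 * j - 1" "e - d" "e + d"] assms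
    by (simp add: cycle_hook_formula_eq_fdiff)
  also have "\<dots> = (\<Sum>k\<le>j. - ((-1) ^ (j - k) * fact (2 * j + 2 * k) /
      (fact (j - k) * fact (j + k) * fact (2 * k + 1))) * (?e k * ?d k))"
    unfolding fdiff_shifted_square_prod_expansion [OF assms] sum_negf [symmetric] sum_divide_distrib
    by (intro sum.cong refl) (simp add: field_simps del: fact_Suc)
  also have "\<dots> =
      (\<Sum>k\<le>j. (-1) ^ (j - 1) * of_nat ((2 * j - 1) choose j) * (2 * gcoeff k j) * (?e k * ?d k))"
    by (intro sum.cong refl) (simp only: binomial_mult_gcoeff_eq_fact [OF assms] atMost_iff)
  finally show ?thesis
    unfolding sum_distrib_left atLeast0AtMost by (simp add: mult_ac)
qed

end
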